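(* Let $C=\langle a,b\rangle$ be a non-linear HFP-code of type Q of length $4n=2^s n'$, where $n'$ is odd, and let $r$ and $k$ be the rank of $C$ and the dimension of the kernel of $C$, respectively. (1) If $s=2$, then $C$ has full rank: $r=4n-1$ and $k=1$. (2) If $s=3$, then $r=2n$ and $k\in\{1,2\}$. (3) If $s>3$, then $r\le 2n$ and $k\in\{1,2\}$.
   Context: Let $\mathbb{F}=\mathbb{Z}_2$. $\mathbf 0,\mathbf 1$ denote the all-zero and all-one vectors; for a permutation $\pi$ of $\{1,\dots,m\}$ and $v\in\mathbb{F}^m$, $\pi(v)=(v_{\pi^{-1}(1)},\dots,v_{\pi^{-1}(m)})$. A binary Hadamard matrix of order $4n$ is obtained from a $4n\times4n$ matrix $H$ with entries $\pm1$ and $HH^T=4nI$ by replacing $+1$ by $0$ and $-1$ by $1$; the binary Hadamard code it defines is the set of its rows together with their complements ($8n$ codewords of length $4n$). A code $C\subseteq\mathbb{F}^m$ with $\mathbf 0\in C$ is propelinear if to each $x\in C$ a coordinate permutation $\pi_x$ is assigned such that for all $x,y\in C$: $x+\pi_x(y)\in C$ and $\pi_x\pi_y=\pi_{x+\pi_x(y)}$; then $x\cdot y:=x+\pi_x(y)$ makes $(C,\cdot)$ a group with identity $\mathbf 0$. An HFP-code (Hadamard full propelinear code) of length $4n$ is a propelinear code that is also a binary Hadamard code of length $4n$, with $\pi_{\mathbf 0}=\pi_{\mathbf 1}=\mathrm{id}$ and such that for every $a\in C\setminus\{\mathbf 0,\mathbf 1\}$, $\pi_a$ has no fixed coordinate.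 An HFP-code $C$ of length $4n$ is of type Q, written $C=\langle a,b\rangle$, if there are $a,b\in C$ generating $(C,\cdot)$ such that $(C,\cdot)$ has the presentation $\langle a,b: a^{4n}=\mathbf 0,\ a^{2n}=b^2,\ b^{-1}ab=a^{-1}\rangle$ (powers and inverses in $(C,\cdot)$). The rank of a code is the dimension of its linear span over $\mathbb{F}$; the kernel is $K(C)=\{z\in\mathbb{F}^m: C+z=C\}$, a linear subspace whose dimension is denoted $k$. $C$ is linear if it is a linear subspace. *)

theory Defs
  imports "HOL-Analysis.Analysis" "HOL-Algebra.Generated_Groups" "HOL-Library.Z2"
begin

text \<open>
  Vectors in \<open>\<bbbF>\<^sup>m\<close> have type \<open>bit ^ 'm\<close>, where \<open>m = CARD('m)\<close>.
  The vectors \<open>0\<close> and \<open>1\<close> of this type are componentwise constant, so \<open>1\<close> is the all-one vector.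
\<close>

definition perm_vec :: "('m \<Rightarrow> 'm) \<Rightarrow> 'a ^ 'm \<Rightarrow> 'a ^ 'm" where
  "perm_vec \<sigma> v = (\<chi> i. v $ (inv_into UNIV \<sigma> i))"

definition hadamard_matrix :: "int ^ 'm ^ 'm \<Rightarrow> bool" where
  "hadamard_matrix H \<longleftrightarrow>
     (\<forall>i j. H $ i $ j = 1 \<or> H $ i $ j = -1) \<and> H ** transpose H = mat (int CARD('m))"

definition binary_matrix :: "int ^ 'm ^ 'm \<Rightarrow> bit ^ 'm ^ 'm" where
  "binary_matrix H = (\<chi> i j. if H $ i $ j = 1 then 0 else 1)"

definition hadamard_code :: "(bit ^ 'm) set \<Rightarrow> bool" where
  "hadamard_code C \<longleftrightarrow>
     (\<exists>H. hadamard_matrix H \<and>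
        C = rows (binary_matrix H) \<union> (\<lambda>v. v + 1) ` rows (binary_matrix H))"

text \<open>
  The assignment \<open>x \<mapsto> \<pi>\<^sub>x\<close> is a total function; its values outside \<open>C\<close> are irrelevant.
\<close>

definition propelinear :: "(bit ^ 'm) set \<Rightarrow> (bit ^ 'm \<Rightarrow> 'm \<Rightarrow> 'm) \<Rightarrow> bool" where
  "propelinear C \<pi> \<longleftrightarrow>
     0 \<in> C \<and> (\<forall>x\<in>C. \<pi> x permutes UNIV) \<and>
     (\<forall>x\<in>C. \<forall>y\<in>C. x + perm_vec (\<pi> x) y \<in> C \<and>
        \<pi> x \<circ> \<pi> y = \<pi> (x + perm_vec (\<pi> x) y))"

definition propelinear_group ::
    "(bit ^ 'm) set \<Rightarrow> (bit ^ 'm \<Rightarrow> 'm \<Rightarrow> 'm) \<Rightarrow> (bit ^ 'm) monoid" where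
  "propelinear_group C \<pi> =
     \<lparr>carrier = C, monoid.mult = (\<lambda>x y. x + perm_vec (\<pi> x) y), one = 0\<rparr>"

lemma perm_vec_add:
  fixes u v :: "bit ^ 'm"
  shows "perm_vec \<sigma> (u + v) = perm_vec \<sigma> u + perm_vec \<sigma> v"
  by (simp add: perm_vec_def vec_eq_iff)

lemma perm_vec_comp:
  assumes "\<sigma> permutes UNIV" "\<tau> permutes UNIV"
  shows "perm_vec (\<sigma> \<circ> \<tau>) v = perm_vec \<sigma> (perm_vec \<tau> v)"
  using assms by (simp add: perm_vec_def vec_eq_iff o_inv_distrib permutes_bij)

lemma perm_vec_inj: "\<sigma> permutes UNIV \<Longrightarrow> perm_vec \<sigma> u = perm_vec \<sigma> v \<Longrightarrow> u = v"
  by (metis (no_types, lifting) perm_vec_def permutes_inverses(2) vec_eq_iff vec_lambda_beta)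

lemma group_propelinear_group:
  fixes C :: "(bit ^ 'm) set"
  assumes "propelinear C \<pi>"
  shows "group (propelinear_group C \<pi>)"
proof -
  let ?m = "\<lambda>x y. x + perm_vec (\<pi> x) y"
  have zero: "0 \<in> C" and perm: "\<And>x. x \<in> C \<Longrightarrow> \<pi> x permutes UNIV"
    and closed: "\<And>x y. x \<in> C \<Longrightarrow> y \<in> C \<Longrightarrow> ?m x y \<in> C"
    and comp: "\<And>x y. x \<in> C \<Longrightarrow> y \<in> C \<Longrightarrow> \<pi> (?m x y) = \<pi> x \<circ> \<pi> y"
    using assms unfolding propelinear_def by metis+
  have right0: "?m x 0 = x" for x
    by (simp add: perm_vec_def vec_eq_iff)
  have "\<pi> 0 \<circ> \<pi> 0 = \<pi> 0"
    using comp[OF zero zero] right0[of 0] by simp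
  then have pi0: "\<pi> 0 = id"
    using permutes_inj[OF perm[OF zero]] by (auto simp: fun_eq_iff dest: injD)
  have left0: "?m 0 x = x" for x
    by (simp add: pi0 perm_vec_def vec_eq_iff)
  have assoc: "?m (?m x y) z = ?m x (?m y z)" if "x \<in> C" "y \<in> C" for x y z
    using that by (simp add: comp perm perm_vec_comp perm_vec_add add.assoc)
  have fin: "finite C"
  proof (rule finite_subset)
    show "C \<subseteq> (\<lambda>f. \<chi> i. f i) ` (UNIV \<rightarrow>\<^sub>E {0, 1})"
    proof
      fix x assume "x \<in> C"
      have "x $ i \<in> {0, 1}" for i
        by (cases "x $ i = 0") simp_all
      then have "($) x \<in> UNIV \<rightarrow>\<^sub>E {0, 1}"
        by (simp only: PiE_UNIV_domain Pi_I)
      then show "x \<in> (\<lambda>f. \<chi> i. f i) ` (UNIV \<rightarrow>\<^sub>E {0, 1})"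
        by (rule image_eqI[rotated]) (simp only: vec_lambda_eta)
    qed
    show "finite ((\<lambda>f. \<chi> i. f i) ` (UNIV \<rightarrow>\<^sub>E {0, 1}) :: (bit ^ 'm) set)"
      by (intro finite_imageI finite_PiE) auto
  qed
  have ex_right: "\<exists>y\<in>C. ?m x y = 0" if x: "x \<in> C" for x
  proof -
    have "inj_on (?m x) C"
      using perm_vec_inj[OF perm[OF x]] by (auto intro!: inj_onI)
    moreover have "?m x ` C \<subseteq> C"
      using closed[OF x] by auto
    ultimately have "?m x ` C = C"
      using endo_inj_surj[OF fin] by simp
    then have "0 \<in> ?m x ` C"
      using zero by (simp only:)
    then obtain y where "y \<in> C" "0 = ?m x y"
      by (rule imageE)
    then show ?thesis
      by (intro bexI[of _ y]) (rule sym)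
  qed
  have ex_left: "\<exists>y\<in>C. ?m y x = 0" if x: "x \<in> C" for x
  proof -
    obtain y where y: "y \<in> C" "?m x y = 0" using ex_right[OF x] by blast
    obtain z where z: "z \<in> C" "?m y z = 0" using ex_right[OF y(1)] by blast
    have "z = ?m (?m x y) z"
      by (simp only: y(2) left0)
    also have "\<dots> = x"
      by (simp only: assoc[OF x y(1)] z(2) right0)
    finally show ?thesis
      using y(1) z(2) by (intro bexI[of _ y]) (simp_all only:)
  qed
  have simps: "carrier (propelinear_group C \<pi>) = C"
      "x \<otimes>\<^bsub>propelinear_group C \<pi>\<^esub> y = ?m x y" "\<one>\<^bsub>propelinear_group C \<pi>\<^esub> = 0" for x y
    by (simp_all add: propelinear_group_def)
  show ?thesis
  proof (rule groupI)
    fix x assume "x \<in> carrier (propelinear_group C \<pi>)"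
    then show "\<exists>y\<in>carrier (propelinear_group C \<pi>).
        y \<otimes>\<^bsub>propelinear_group C \<pi>\<^esub> x = \<one>\<^bsub>propelinear_group C \<pi>\<^esub>"
      unfolding simps by (rule ex_left)
  qed (simp_all only: simps closed zero assoc left0)
qed

definition hfp_code :: "(bit ^ 'm) set \<Rightarrow> (bit ^ 'm \<Rightarrow> 'm \<Rightarrow> 'm) \<Rightarrow> bool" where
  "hfp_code C \<pi> \<longleftrightarrow>
     propelinear C \<pi> \<and> hadamard_code C \<and> \<pi> 0 = id \<and> \<pi> 1 = id \<and>
     (\<forall>x \<in> C - {0, 1}. \<forall>i. \<pi> x i \<noteq> i)"

text \<open>
  Group presentations. A letter \<open>(g, True)\<close> stands for the generator \<open>g\<close> and \<open>(g, False)\<close> for its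
  formal inverse; a relation is a pair of words. The words modulo \<open>presented_eq R\<close> form the
  group presented by \<open>R\<close>: the free group on the generators modulo the normal closure of the relations.
\<close>

type_synonym 'g word = "('g \<times> bool) list"

inductive presented_eq :: "('g word \<times> 'g word) set \<Rightarrow> 'g word \<Rightarrow> 'g word \<Rightarrow> bool"
  for R :: "('g word \<times> 'g word) set" where
  relation: "(u, v) \<in> R \<Longrightarrow> presented_eq R u v"
| cancel: "presented_eq R [(g, e), (g, \<not> e)] []"
| refl: "presented_eq R u u"
| sym: "presented_eq R u v \<Longrightarrow> presented_eq R v u"
| trans: "presented_eq R u v \<Longrightarrow> presented_eq R v w \<Longrightarrow> presented_eq R u w"
| append: "presented_eq R u u' \<Longrightarrow> presented_eq R v v' \<Longrightarrow> presented_eq R (u @ v) (u' @ v')"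

fun word_eval :: "('a, 'x) monoid_scheme \<Rightarrow> ('g \<Rightarrow> 'a) \<Rightarrow> 'g word \<Rightarrow> 'a" where
  "word_eval G f [] = \<one>\<^bsub>G\<^esub>"
| "word_eval G f ((g, e) # w) = (if e then f g else inv\<^bsub>G\<^esub> (f g)) \<otimes>\<^bsub>G\<^esub> word_eval G f w"

definition has_presentation ::
    "('a, 'x) monoid_scheme \<Rightarrow> ('g \<Rightarrow> 'a) \<Rightarrow> ('g word \<times> 'g word) set \<Rightarrow> bool" where
  "has_presentation G f R \<longleftrightarrow>
     range f \<subseteq> carrier G \<and> generate G (range f) = carrier G \<and>
     (\<forall>u v. word_eval G f u = word_eval G f v \<longleftrightarrow> presented_eq R u v)"

datatype gen = Gen_a | Gen_b

definition type_Q_relations :: "nat \<Rightarrow> (gen word \<times> gen word) set" where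
  "type_Q_relations n =
     {(replicate (4 * n) (Gen_a, True), []),
      (replicate (2 * n) (Gen_a, True), [(Gen_b, True), (Gen_b, True)]),
      ([(Gen_b, False), (Gen_a, True), (Gen_b, True)], [(Gen_a, False)])}"

definition type_Q ::
    "nat \<Rightarrow> (bit ^ 'm) set \<Rightarrow> (bit ^ 'm \<Rightarrow> 'm \<Rightarrow> 'm) \<Rightarrow> bit ^ 'm \<Rightarrow> bit ^ 'm \<Rightarrow> bool" where
  "type_Q n C \<pi> a b \<longleftrightarrow>
     has_presentation (propelinear_group C \<pi>) (case_gen a b) (type_Q_relations n)"

definition code_rank :: "(bit ^ 'm) set \<Rightarrow> nat" where
  "code_rank C = vec.dim (vec.span C)"

definition code_kernel :: "(bit ^ 'm) set \<Rightarrow> (bit ^ 'm) set" where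
  "code_kernel C = {z. (\<lambda>c. c + z) ` C = C}"

end

theory Submission
  imports Defs "HOL-Algebra.Multiplicative_Group" "HOL-Combinatorics.Cycles"
begin

text \<open>
  Rank. Let \<open>S\<close> be the span of the code and \<open>H\<close> the \<open>\<plusminus>1\<close> matrix. If \<open>v\<close> is orthogonal to \<open>S\<close>, then
  \<open>H v\<close> is constant modulo 4, and \<open>4 n v = H\<^sup>T (H v)\<close> expresses \<open>v\<close> modulo 2 through the code. Hence
  the dual of \<open>S\<close> is \<open>{0, 1}\<close> for odd \<open>n\<close> and is contained in \<open>S\<close> if \<open>n\<close> is twice an odd number,
  whereas \<open>S\<close> is self-orthogonal for even \<open>n\<close>.

  Kernel. The coordinates split into \<open>2\<^bsup>k-1\<^esup>\<close> blocks on which the kernel words agree. For a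
  non-linear code each block carries at least three orthogonal \<open>\<plusminus>1\<close> vectors, so its length
  \<open>8n / 2\<^sup>k\<close> is divisible by 4, that is, \<open>k < s\<close>. If \<open>k > 2\<close>, then the kernel, being a subgroup of order
  \<open>2\<^sup>k\<close> of a dicyclic group, contains an element \<open>w\<close> of order 4 among the powers of \<open>a\<^sup>n\<close>; since
  \<open>k < s\<close>, the permutation \<open>\<pi>\<^sub>w\<close> fixes the kernel pointwise, and \<open>w \<cdot> w = w + w = 0\<close>.
\<close>

section \<open>Binary vector spaces and dual codes\<close>

text \<open>Bits keep their field operations instead of Boolean ones, so that the ring and linear
  algebra lemmas apply.\<close>

declare add_bit_eq_xor [simp del] mult_bit_eq_and [simp del]

lemma bit_add_self [simp]: "(x::bit) + x = 0"
  by (cases x) (simp_all add: add_bit_eq_xor)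

lemma bit_vec_add_self [simp]: "(v :: bit ^ 'm) + v = 0"
  by (simp add: vec_eq_iff)

lemma bit_vec_add_cancel [simp]: "(u :: bit ^ 'm) + v + v = u" "v + (v + u) = u"
  by (simp add: add.assoc, simp flip: add.assoc)

lemma UNIV_bit: "(UNIV :: bit set) = {0, 1}"
  using bit.exhaust by auto

instance bit :: finite
  by standard (simp add: UNIV_bit)

lemma card_bit [simp]: "CARD(bit) = 2"
  by (simp add: UNIV_bit)

text \<open>The only scalars are 0 and 1, so closure under scaling amounts to containing 0.\<close>

lemma subspace_bit_vec_iff:
  "vec.subspace (S :: (bit ^ 'm) set) \<longleftrightarrow> 0 \<in> S \<and> (\<forall>x\<in>S. \<forall>y\<in>S. x + y \<in> S)"
proof -
  have "c *s x = (if c = 0 then 0 else x)" for c :: bit and x :: "bit ^ 'm"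
    by simp
  then show ?thesis
    unfolding vec.subspace_def by auto
qed

text \<open>Each new basis vector \<open>b\<close> doubles the span: the old span and its translate
  by \<open>b\<close> are disjoint and exhaust the new one.\<close>

lemma card_bit_span_independent:
  assumes "finite B" "vec.independent (B :: (bit ^ 'm) set)"
  shows "card (vec.span B) = 2 ^ card B"
  using assms
proof (induction B)
  case empty
  then show ?case by simp
next
  case (insert b B)
  have ind: "vec.independent B" "b \<notin> vec.span B"
    using insert.prems insert.hyps by (simp_all add: vec.independent_insert)
  have eq: "vec.span (insert b B) = vec.span B \<union> (\<lambda>x. x + b) ` vec.span B"
  proof (intro equalityI subsetI)
    fix x assume "x \<in> vec.span (insert b B)"
    then obtain c where c: "x - c *s b \<in> vec.span B"
      by (auto simp: vec.span_breakdown_eq)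
    show "x \<in> vec.span B \<union> (\<lambda>x. x + b) ` vec.span B"
    proof (cases "c = 0")
      case True
      then show ?thesis using c by auto
    next
      case False
      then have "x - b \<in> vec.span B" "x = (x - b) + b"
        using c by auto
      then show ?thesis by blast
    qed
  next
    fix x assume "x \<in> vec.span B \<union> (\<lambda>x. x + b) ` vec.span B"
    moreover have "vec.span B \<subseteq> vec.span (insert b B)"
      by (intro vec.span_mono) blast
    moreover have "b \<in> vec.span (insert b B)"
      by (simp add: vec.span_base)
    ultimately show "x \<in> vec.span (insert b B)"
      by (blast intro: vec.span_add)
  qed
  have "vec.span B \<inter> (\<lambda>x. x + b) ` vec.span B = {}"
  proof (rule ccontr)
    assume "\<not> ?thesis"
    then obtain x where "x \<in> vec.span B" "x + b \<in> vec.span B" by auto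
    then have "(x + b) - x \<in> vec.span B" by (rule vec.span_diff[rotated])
    then show False using ind by simp
  qed
  then have "card (vec.span (insert b B)) = card (vec.span B) + card ((\<lambda>x. x + b) ` vec.span B)"
    unfolding eq by (intro card_Un_disjoint) auto
  also have "card ((\<lambda>x. x + b) ` vec.span B) = card (vec.span B)"
    by (intro card_image inj_onI) auto
  finally show ?case
    using insert ind by simp
qed

lemma card_bit_subspace:
  assumes "vec.subspace (S :: (bit ^ 'm) set)"
  shows "card S = 2 ^ vec.dim S"
proof -
  obtain B where B: "B \<subseteq> S" "vec.independent B" "S \<subseteq> vec.span B" "card B = vec.dim S"
    using vec.basis_exists[of S] by blast
  then have "vec.span B = S"
    using assms by (intro vec.span_subspace)
  then show ?thesis
    using card_bit_span_independent[OF finite B(2)] B(4) by simp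
qed

section \<open>Character sums and the size of the dual code\<close>

definition bit_sign :: "bit \<Rightarrow> int" where
  "bit_sign x = (if x = 0 then 1 else - 1)"

lemma bit_sign_simps [simp]: "bit_sign 0 = 1" "bit_sign 1 = - 1"
  by (simp_all add: bit_sign_def)

lemma bit_sign_add: "bit_sign (x + y) = bit_sign x * bit_sign y"
  by (cases "x = 0"; cases "y = 0") simp_all

text \<open>If \<open>f y = 1\<close> for some \<open>y\<close> in \<open>S\<close>, translation by
  \<open>y\<close> permutes \<open>S\<close> and flips every sign, so the sum equals its own
  negative.\<close>

lemma sum_bit_sign:
  fixes f :: "'a :: ab_group_add \<Rightarrow> bit"
  assumes "finite S" and add: "\<And>x y. x \<in> S \<Longrightarrow> y \<in> S \<Longrightarrow> x + y \<in> S"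
    and f: "\<And>x y. x \<in> S \<Longrightarrow> y \<in> S \<Longrightarrow> f (x + y) = f x + f y"
  shows "(\<Sum>x\<in>S. bit_sign (f x)) = (if \<forall>x\<in>S. f x = 0 then int (card S) else 0)"
proof (cases "\<forall>x\<in>S. f x = 0")
  case True
  then show ?thesis by simp
next
  case False
  then obtain y where y: "y \<in> S" "f y = 1" by auto
  have inj: "inj_on (\<lambda>x. x + y) S" by (auto intro: inj_onI)
  have "(\<lambda>x. x + y) ` S \<subseteq> S" by (auto intro: add y)
  then have "(\<lambda>x. x + y) ` S = S" by (intro endo_inj_surj assms(1) inj)
  then have "(\<Sum>x\<in>S. bit_sign (f x)) = (\<Sum>x\<in>S. bit_sign (f (x + y)))"
    using sum.reindex[OF inj, of "\<lambda>x. bit_sign (f x)"] by (simp only: o_def)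
  also have "\<dots> = (\<Sum>x\<in>S. - bit_sign (f x))"
    by (intro sum.cong HOL.refl) (simp add: y f bit_sign_add)
  also have "\<dots> = - (\<Sum>x\<in>S. bit_sign (f x))"
    by (rule sum_negf)
  finally show ?thesis using False by auto
qed

definition bit_dot :: "bit ^ 'm \<Rightarrow> bit ^ 'm \<Rightarrow> bit" where
  "bit_dot u v = (\<Sum>i\<in>UNIV. u $ i * v $ i)"

lemma bit_dot_add_left: "bit_dot (u + v) w = bit_dot u w + bit_dot v w"
  by (simp add: bit_dot_def distrib_right sum.distrib)

lemma bit_dot_commute: "bit_dot u v = bit_dot v u"
  by (simp add: bit_dot_def mult.commute)

lemma bit_dot_add_right: "bit_dot w (u + v) = bit_dot w u + bit_dot w v"
  by (simp add: bit_dot_commute[of w] bit_dot_add_left)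

lemma bit_dot_axis: "bit_dot (axis i 1) v = v $ i"
proof -
  have "bit_dot (axis i 1) v = (\<Sum>j\<in>UNIV. if j = i then v $ i else 0)"
    unfolding bit_dot_def by (intro sum.cong) (auto simp: axis_def)
  then show ?thesis by simp
qed

definition dual_code :: "(bit ^ 'm) set \<Rightarrow> (bit ^ 'm) set" where
  "dual_code S = {v. \<forall>x\<in>S. bit_dot v x = 0}"

lemma subspace_dual_code: "vec.subspace (dual_code S)"
  unfolding subspace_bit_vec_iff dual_code_def by (simp add: bit_dot_add_left) (simp add: bit_dot_def)

lemma dual_code_span: "dual_code (vec.span S) = dual_code S"
proof
  show "dual_code S \<subseteq> dual_code (vec.span S)"
  proof
    fix v assume "v \<in> dual_code S"
    then have "S \<subseteq> dual_code {v}"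
      by (auto simp: dual_code_def bit_dot_commute)
    then have "vec.span S \<subseteq> dual_code {v}"
      by (intro vec.span_minimal subspace_dual_code)
    then show "v \<in> dual_code (vec.span S)"
      by (auto simp: dual_code_def bit_dot_commute)
  qed
qed (auto simp: dual_code_def vec.span_base)

text \<open>Double counting of the signs of \<open>bit_dot v x\<close>. Summed over \<open>x\<close>
  first, each \<open>v\<close> in the dual contributes \<open>card S\<close>; summed over
  \<open>v\<close> first, only \<open>x = 0\<close> contributes.\<close>

lemma card_mult_card_dual_code:
  assumes "vec.subspace (S :: (bit ^ 'm) set)"
  shows "card S * card (dual_code S) = 2 ^ CARD('m)"
proof -
  have S: "0 \<in> S" "\<And>x y. x \<in> S \<Longrightarrow> y \<in> S \<Longrightarrow> x + y \<in> S"
    using assms by (auto simp: subspace_bit_vec_iff)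
  have "(\<Sum>v\<in>UNIV. \<Sum>x\<in>S. bit_sign (bit_dot v x))
      = (\<Sum>v\<in>UNIV. if v \<in> dual_code S then int (card S) else 0)"
  proof (intro sum.cong HOL.refl)
    fix v :: "bit ^ 'm"
    show "(\<Sum>x\<in>S. bit_sign (bit_dot v x)) = (if v \<in> dual_code S then int (card S) else 0)"
      using sum_bit_sign[of S "bit_dot v"] S by (simp add: bit_dot_add_right dual_code_def)
  qed
  also have "\<dots> = int (card S * card (dual_code S))"
    by (simp add: sum.If_cases)
  finally have 1: "(\<Sum>v\<in>UNIV. \<Sum>x\<in>S. bit_sign (bit_dot v x)) = int (card S * card (dual_code S))" .
  have "(\<forall>v. bit_dot v x = 0) \<longleftrightarrow> x = 0" for x :: "bit ^ 'm"
  proof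
    assume "\<forall>v. bit_dot v x = 0"
    then have "x $ i = 0" for i using bit_dot_axis[of i x] by simp
    then show "x = 0" by (simp add: vec_eq_iff)
  qed (simp add: bit_dot_def)
  then have "(\<Sum>x\<in>S. \<Sum>v\<in>UNIV. bit_sign (bit_dot v x))
      = (\<Sum>x\<in>S. if x = 0 then 2 ^ CARD('m) else 0)"
    using sum_bit_sign[of UNIV "\<lambda>v :: bit ^ 'm. bit_dot v _"]
    by (intro sum.cong HOL.refl) (simp add: bit_dot_add_left)
  also have "\<dots> = 2 ^ CARD('m)"
    using S by simp
  finally have "int (card S * card (dual_code S)) = int (2 ^ CARD('m))"
    using 1 sum.swap[of "\<lambda>v x. bit_sign (bit_dot v x)" S UNIV] by simp
  then show ?thesis
    by (simp only: of_nat_eq_iff)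
qed

section \<open>The rank of a Hadamard code\<close>

text \<open>This is the length minus twice the Hamming weight; at \<open>u + v\<close> it is the
  inner product of the \<plusminus>1 vectors belonging to \<open>u\<close> and
  \<open>v\<close>.\<close>

definition sign_sum :: "bit ^ 'm \<Rightarrow> int" where
  "sign_sum v = (\<Sum>i\<in>UNIV. bit_sign (v $ i))"

lemma sign_sum_zero [simp]: "sign_sum (0 :: bit ^ 'm) = int CARD('m)"
  by (simp add: sign_sum_def)

lemma sign_sum_complement [simp]: "sign_sum (v + 1) = - sign_sum v"
  by (simp add: sign_sum_def bit_sign_add sum_negf)

lemma sign_sum_one [simp]: "sign_sum (1 :: bit ^ 'm) = - int CARD('m)"
  using sign_sum_complement[of "0 :: bit ^ 'm"] by simp

text \<open>Over the reals the transpose divided by the order is a right inverse of the matrix,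
  hence also a left inverse.\<close>

lemma hadamard_matrix_columns:
  fixes H :: "int ^ 'm ^ 'm"
  assumes "hadamard_matrix H"
  shows "(\<Sum>r\<in>UNIV. H $ r $ i * H $ r $ j) = (if i = j then int CARD('m) else 0)"
proof -
  define N where "N = real CARD('m)"
  define A :: "real ^ 'm ^ 'm" where "A = (\<chi> i j. real_of_int (H $ i $ j))"
  define B :: "real ^ 'm ^ 'm" where "B = (\<chi> i j. real_of_int (H $ j $ i) / N)"
  have N: "N \<noteq> 0" by (simp add: N_def)
  have rows: "(\<Sum>k\<in>UNIV. H $ i $ k * H $ j $ k) = (if i = j then int CARD('m) else 0)" for i j
    using assms unfolding hadamard_matrix_def
    by (simp add: matrix_matrix_mult_def transpose_def vec_eq_iff mat_def)
  have "(\<Sum>k\<in>UNIV. real_of_int (H $ i $ k) * real_of_int (H $ j $ k)) = (if i = j then N else 0)" for i j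
    using arg_cong[OF rows[of i j], of real_of_int] by (simp add: N_def)
  then have "A ** B = mat 1"
    using N by (simp add: A_def B_def matrix_matrix_mult_def mat_def vec_eq_iff flip: sum_divide_distrib)
  then have "B ** A = mat 1"
    by (rule matrix_left_right_inverse1)
  then have "(\<Sum>r\<in>UNIV. real_of_int (H $ r $ i) * real_of_int (H $ r $ j) / N) = (if i = j then 1 else 0)"
    by (simp add: A_def B_def matrix_matrix_mult_def mat_def vec_eq_iff)
  then have "real_of_int (\<Sum>r\<in>UNIV. H $ r $ i * H $ r $ j) = (if i = j then N else 0)"
    using N by (simp add: field_simps flip: sum_divide_distrib split: if_splits)
  then have "real_of_int (\<Sum>r\<in>UNIV. H $ r $ i * H $ r $ j)
      = real_of_int (if i = j then int CARD('m) else 0)"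
    by (simp add: N_def)
  then show ?thesis
    by (simp only: of_int_eq_iff)
qed

text \<open>Negating rows of the Hadamard matrix does not change the code, so column \<open>e\<close> may be
  assumed to vanish.\<close>

lemma hadamard_code_rows:
  fixes C :: "(bit ^ 'm) set"
  assumes "hadamard_code C"
  obtains h :: "'m \<Rightarrow> bit ^ 'm"
  where "C = range h \<union> (\<lambda>v. v + 1) ` range h"
    and "\<And>r. h r $ e = 0"
    and "\<And>r t. sign_sum (h r + h t) = (if r = t then int CARD('m) else 0)"
    and "\<And>i j. (\<Sum>r\<in>UNIV. bit_sign (h r $ i) * bit_sign (h r $ j)) = (if i = j then int CARD('m) else 0)"
proof -
  obtain H :: "int ^ 'm ^ 'm" where H: "hadamard_matrix H"
    and C: "C = rows (binary_matrix H) \<union> (\<lambda>v. v + 1) ` rows (binary_matrix H)"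
    using assms by (auto simp: hadamard_code_def)
  have pm: "H $ i $ j = 1 \<or> H $ i $ j = - 1" for i j
    using H by (auto simp: hadamard_matrix_def)
  define g where "g r = row r (binary_matrix H)" for r
  define h where "h r = (if g r $ e = 0 then g r else g r + 1)" for r
  have g_sign: "bit_sign (g r $ i) = H $ r $ i" for r i
    using pm[of r i] by (auto simp: g_def binary_matrix_def row_def)
  have h_sign: "bit_sign (h r $ i) = (if g r $ e = 0 then 1 else - 1) * H $ r $ i" for r i
    by (simp add: h_def bit_sign_add g_sign)
  have "rows (binary_matrix H) = range g"
    by (auto simp: rows_def g_def)
  then have C': "C = range g \<union> (\<lambda>v. v + 1) ` range g"
    using C by simp
  show thesis
  proof
    have "h r \<in> C" "h r + 1 \<in> C" for r
      by (auto simp: C' h_def)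
    moreover have "g r \<in> range h \<union> (\<lambda>v. v + 1) ` range h" for r
    proof (cases "g r $ e = 0")
      case True
      then have "g r = h r" by (simp add: h_def)
      then show ?thesis by blast
    next
      case False
      then have "g r = h r + 1" by (simp add: h_def)
      then show ?thesis by blast
    qed
    moreover have "g r + 1 \<in> range h \<union> (\<lambda>v. v + 1) ` range h" for r
    proof (cases "g r $ e = 0")
      case True
      then have "g r + 1 = h r + 1" by (simp add: h_def)
      then show ?thesis by blast
    next
      case False
      then have "g r + 1 = h r" by (simp add: h_def)
      then show ?thesis by blast
    qed
    ultimately show "C = range h \<union> (\<lambda>v. v + 1) ` range h"
      unfolding C' by blast
    show "h r $ e = 0" for r
      by (simp add: h_def)
    show "sign_sum (h r + h t) = (if r = t then int CARD('m) else 0)" for r t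
    proof -
      have "(\<Sum>i\<in>UNIV. H $ r $ i * H $ t $ i) = (if r = t then int CARD('m) else 0)"
        using H unfolding hadamard_matrix_def
        by (simp add: matrix_matrix_mult_def transpose_def vec_eq_iff mat_def)
      moreover have "sign_sum (h r + h t) = (if g r $ e = 0 then 1 else - 1) * (if g t $ e = 0 then 1 else - 1)
          * (\<Sum>i\<in>UNIV. H $ r $ i * H $ t $ i)"
        unfolding sign_sum_def sum_distrib_left by (intro sum.cong HOL.refl) (simp add: bit_sign_add h_sign)
      ultimately show ?thesis by auto
    qed
    show "(\<Sum>r\<in>UNIV. bit_sign (h r $ i) * bit_sign (h r $ j)) = (if i = j then int CARD('m) else 0)" for i j
      unfolding hadamard_matrix_columns[OF H, symmetric] h_sign by (intro sum.cong HOL.refl) simp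
  qed
qed

lemma hadamard_code_complement:
  assumes "hadamard_code C" "c \<in> C"
  shows "c + 1 \<in> C"
  using assms by (auto simp: hadamard_code_def)

text \<open>Up to complements the two words are different rows, and complementing only changes the
  sign of \<open>sign_sum\<close>.\<close>

lemma hadamard_code_sign_sum:
  fixes C :: "(bit ^ 'm) set"
  assumes "hadamard_code C" "c \<in> C" "d \<in> C" "c \<noteq> d" "c \<noteq> d + 1"
  shows "sign_sum (c + d) = 0"
proof -
  \<comment> \<open>The rows are normalised at \<open>undefined\<close>, which stands for an
    arbitrary coordinate.\<close>
  obtain h :: "'m \<Rightarrow> bit ^ 'm" where C: "C = range h \<union> (\<lambda>v. v + 1) ` range h"
    and e: "\<And>r. h r $ undefined = 0"
    and row: "\<And>r t. sign_sum (h r + h t) = (if r = t then int CARD('m) else 0)"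
    and col: "\<And>i j. (\<Sum>r\<in>UNIV. bit_sign (h r $ i) * bit_sign (h r $ j))
      = (if i = j then int CARD('m) else 0)"
    using hadamard_code_rows[OF assms(1), of undefined] by blast
  obtain r where c: "c = h r \<or> c = h r + 1" using assms(2) C by blast
  obtain t where d: "d = h t \<or> d = h t + 1" using assms(3) C by blast
  have "r \<noteq> t" using assms(4,5) c d by auto
  moreover have "c + d = h r + h t \<or> c + d = h r + h t + 1"
    using c d by (elim disjE) (simp_all add: add.assoc add.commute add.left_commute)
  ultimately show ?thesis using row[of r t] by auto
qed

lemma hadamard_code_sign_sum_dvd:
  fixes C :: "(bit ^ 'm) set"
  assumes "hadamard_code C" "c \<in> C" "d \<in> C"
  shows "int CARD('m) dvd sign_sum (c + d)"
  using hadamard_code_sign_sum[OF assms] by (cases "c = d"; cases "c = d + 1") (auto simp: algebra_simps)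

text \<open>Orthogonality separates the rows; since all of them vanish at one common coordinate, no
  row is the complement of another.\<close>

lemma card_hadamard_code:
  fixes C :: "(bit ^ 'm) set"
  assumes "hadamard_code C"
  shows "card C = 2 * CARD('m)"
proof -
  obtain h :: "'m \<Rightarrow> bit ^ 'm" where C: "C = range h \<union> (\<lambda>v. v + 1) ` range h"
    and e: "\<And>r. h r $ undefined = 0"
    and row: "\<And>r t. sign_sum (h r + h t) = (if r = t then int CARD('m) else 0)"
    and col: "\<And>i j. (\<Sum>r\<in>UNIV. bit_sign (h r $ i) * bit_sign (h r $ j))
      = (if i = j then int CARD('m) else 0)"
    using hadamard_code_rows[OF assms(1), of undefined] by blast
  have "inj h"
  proof (rule injI)
    fix r t assume "h r = h t"
    then show "r = t" using row[of r t] by (simp split: if_splits)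
  qed
  moreover have "range h \<inter> (\<lambda>v. v + 1) ` range h = {}"
  proof (rule equals0I)
    fix x assume "x \<in> range h \<inter> (\<lambda>v. v + 1) ` range h"
    then obtain r t where x: "x = h r" "x = h t + 1" by blast
    have "x $ undefined = 0" by (simp add: x(1) e)
    moreover have "x $ undefined = 1" by (simp add: x(2) e)
    ultimately show False by simp
  qed
  moreover have "inj (\<lambda>v :: bit ^ 'm. v + 1)" by (auto intro: injI)
  ultimately show ?thesis
    unfolding C by (subst card_Un_disjoint) (simp_all add: card_image inj_on_subset)
qed

section \<open>Overlaps of words and the dual of a Hadamard code\<close>

text \<open>The lift of bits to integers makes inner products visible beyond their parity;
  \<open>of_int\<close> reduces back modulo 2.\<close>

definition bit_int :: "bit \<Rightarrow> int" where
  "bit_int x = (if x = 0 then 0 else 1)"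

lemma even_bit_int_iff [simp]: "even (bit_int x) \<longleftrightarrow> x = 0"
  by (simp add: bit_int_def)

lemma bit_int_mult: "bit_int (x * y) = bit_int x * bit_int y"
  by (cases "x = 0"; cases "y = 0") (simp_all add: bit_int_def)

lemma of_int_bit_int [simp]: "of_int (bit_int x) = x"
  by (cases "x = 0") (simp_all add: bit_int_def)

lemma bit_sign_bit_int: "bit_sign x = 1 - 2 * bit_int x"
  by (simp add: bit_int_def bit_sign_def)

lemma of_int_bit_eq_0_iff: "(of_int k :: bit) = 0 \<longleftrightarrow> even k"
proof
  assume "even k"
  then show "(of_int k :: bit) = 0" by (auto elim!: evenE)
next
  assume k: "(of_int k :: bit) = 0"
  show "even k"
  proof (rule ccontr)
    assume "odd k"
    then show False using k by (auto elim!: oddE)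
  qed
qed

lemma bit_dot_of_int: "bit_dot u v = of_int (\<Sum>i\<in>UNIV. bit_int (u $ i) * bit_int (v $ i))"
  by (simp add: bit_dot_def flip: bit_int_mult)

text \<open>If s and t are the signs of bits x and y, then (1 - s)(1 - t) = 4xy; this is summed over
  all coordinates.\<close>

lemma sum_bit_int_mult:
  fixes u v :: "bit ^ 'm"
  shows "4 * (\<Sum>i\<in>UNIV. bit_int (u $ i) * bit_int (v $ i))
    = int CARD('m) - sign_sum u - sign_sum v + sign_sum (u + v)"
proof -
  have "int CARD('m) - sign_sum u - sign_sum v + sign_sum (u + v)
      = (\<Sum>i\<in>UNIV. 1 - bit_sign (u $ i) - bit_sign (v $ i) + bit_sign (u $ i + v $ i))"
    by (simp add: sign_sum_def sum.distrib sum_subtractf)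
  also have "\<dots> = (\<Sum>i\<in>UNIV. 4 * (bit_int (u $ i) * bit_int (v $ i)))"
    unfolding bit_sign_add unfolding bit_sign_bit_int by (intro sum.cong HOL.refl) (simp add: algebra_simps)
  finally show ?thesis by (simp add: sum_distrib_left)
qed

text \<open>All terms in the overlap formula are multiples of 4n, so two words overlap in a multiple
  of n places, an even number.\<close>

lemma hadamard_code_subset_dual:
  fixes C :: "(bit ^ 'm) set"
  assumes "hadamard_code C" "0 \<in> C" "CARD('m) = 4 * n" "even n"
  shows "C \<subseteq> dual_code C"
proof -
  have "bit_dot c d = 0" if "c \<in> C" "d \<in> C" for c d
  proof -
    have "4 * int n dvd 4 * (\<Sum>i\<in>UNIV. bit_int (c $ i) * bit_int (d $ i))"
      using hadamard_code_sign_sum_dvd[OF assms(1) that] assms(3)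
        hadamard_code_sign_sum_dvd[OF assms(1) that(1) assms(2)]
        hadamard_code_sign_sum_dvd[OF assms(1) that(2) assms(2)]
      unfolding sum_bit_int_mult by (intro dvd_add dvd_diff) simp_all
    then have "int n dvd (\<Sum>i\<in>UNIV. bit_int (c $ i) * bit_int (d $ i))"
      by simp
    then have "even (\<Sum>i\<in>UNIV. bit_int (c $ i) * bit_int (d $ i))"
      using assms(4) by (meson dvd_trans even_of_nat)
    then show ?thesis
      unfolding bit_dot_of_int of_int_bit_eq_0_iff .
  qed
  then show ?thesis by (auto simp: dual_code_def)
qed

text \<open>Every word has even weight, because its \<open>sign_sum\<close> is a multiple of
  4n.\<close>

lemma hadamard_code_one_in_dual:
  fixes C :: "(bit ^ 'm) set"
  assumes "hadamard_code C" "0 \<in> C" "CARD('m) = 4 * n"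
  shows "1 \<in> dual_code C"
proof -
  have "bit_dot 1 c = 0" if c: "c \<in> C" for c
  proof -
    have "4 * (\<Sum>i\<in>UNIV. bit_int (c $ i) * bit_int ((1 :: bit ^ 'm) $ i))
        = 2 * (4 * int n - sign_sum c)"
      unfolding sum_bit_int_mult using assms(3) by simp
    moreover obtain k where "sign_sum c = 4 * int n * k"
      using hadamard_code_sign_sum_dvd[OF assms(1) c assms(2)] assms(3) by (auto elim!: dvdE)
    ultimately have "(\<Sum>i\<in>UNIV. bit_int (c $ i) * bit_int ((1 :: bit ^ 'm) $ i)) = 2 * (int n - int n * k)"
      by simp
    then have "even (\<Sum>i\<in>UNIV. bit_int (c $ i) * bit_int ((1 :: bit ^ 'm) $ i))"
      by simp
    then show ?thesis
      unfolding bit_dot_of_int of_int_bit_eq_0_iff by (simp only: mult.commute)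
  qed
  then show ?thesis by (auto simp: dual_code_def)
qed

text \<open>If \<open>v\<close> is orthogonal to the code and \<open>H\<close> is the normalised \<open>\<plusminus>1\<close> matrix, then
  \<open>H v = w - 4 y\<close> with \<open>w\<close> the weight of \<open>v\<close>; applying the transpose of \<open>H\<close> recovers \<open>v\<close>.\<close>

lemma dual_code_expansion:
  fixes h :: "'m \<Rightarrow> bit ^ 'm" and v :: "bit ^ 'm"
  assumes card: "CARD('m) = 4 * n"
    and e: "\<And>r. h r $ e = 0"
    and col: "\<And>i j. (\<Sum>r\<in>UNIV. bit_sign (h r $ i) * bit_sign (h r $ j)) = (if i = j then int CARD('m) else 0)"
    and v: "\<And>r. bit_dot v (h r) = 0" "bit_dot v 1 = 0"
  obtains w :: int and y :: "'m \<Rightarrow> int"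
  where "even w"
    and "\<And>j. int n * bit_int (v $ j) = (if j = e then int n * w else 0) - (\<Sum>r\<in>UNIV. y r)
             + 2 * (\<Sum>r\<in>UNIV. bit_int (h r $ j) * y r)"
proof -
  let ?V = "\<lambda>i. bit_int (v $ i)"
  define w where "w = (\<Sum>i\<in>UNIV. ?V i)"
  have "even w"
    using v(2) unfolding bit_dot_of_int of_int_bit_eq_0_iff by (simp add: w_def bit_int_def)
  have "even (\<Sum>i\<in>UNIV. ?V i * bit_int (h r $ i))" for r
    using v(1)[of r] unfolding bit_dot_of_int of_int_bit_eq_0_iff .
  \<comment> \<open>\<open>y r\<close> is half the overlap of \<open>v\<close> with row
    \<open>r\<close>.\<close>
  then obtain y where y: "\<And>r. (\<Sum>i\<in>UNIV. ?V i * bit_int (h r $ i)) = 2 * y r"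
    unfolding dvd_def by metis
  have Hv: "(\<Sum>i\<in>UNIV. bit_sign (h r $ i) * ?V i) = w - 4 * y r" for r
  proof -
    have "(\<Sum>i\<in>UNIV. bit_sign (h r $ i) * ?V i)
        = (\<Sum>i\<in>UNIV. ?V i - 2 * (?V i * bit_int (h r $ i)))"
      by (intro sum.cong HOL.refl) (simp add: bit_sign_bit_int algebra_simps)
    also have "\<dots> = w - 2 * (2 * y r)"
      by (simp add: sum_subtractf w_def flip: y sum_distrib_left)
    finally show ?thesis by simp
  qed
  have eq: "int n * bit_int (v $ j) = (if j = e then int n * w else 0) - (\<Sum>r\<in>UNIV. y r)
             + 2 * (\<Sum>r\<in>UNIV. bit_int (h r $ j) * y r)" for j
  proof -
    \<comment> \<open>The identity matrix times 4n is replaced by the product of the transpose of H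
      with H, by column orthogonality.\<close>
    have "4 * int n * ?V j = (\<Sum>i\<in>UNIV. (if i = j then 4 * int n else 0) * ?V i)"
      by (simp add: if_distrib[of "\<lambda>x. x * _"] cong: if_cong)
    also have "\<dots> = (\<Sum>i\<in>UNIV. \<Sum>r\<in>UNIV. bit_sign (h r $ j) * (bit_sign (h r $ i) * ?V i))"
    proof (intro sum.cong HOL.refl)
      fix i
      show "(if i = j then 4 * int n else 0) * ?V i = (\<Sum>r\<in>UNIV. bit_sign (h r $ j) * (bit_sign (h r $ i) * ?V i))"
        unfolding mult.assoc[symmetric] sum_distrib_right[symmetric] col card by simp
    qed
    also have "\<dots> = (\<Sum>r\<in>UNIV. bit_sign (h r $ j) * (\<Sum>i\<in>UNIV. bit_sign (h r $ i) * ?V i))"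
      by (subst sum.swap) (simp add: sum_distrib_left)
    also have "\<dots> = (\<Sum>r\<in>UNIV. w * bit_sign (h r $ j) - 4 * y r + 8 * (bit_int (h r $ j) * y r))"
      unfolding Hv by (intro sum.cong HOL.refl) (simp add: bit_sign_bit_int algebra_simps)
    also have "\<dots> = w * (\<Sum>r\<in>UNIV. bit_sign (h r $ j)) - 4 * (\<Sum>r\<in>UNIV. y r)
        + 8 * (\<Sum>r\<in>UNIV. bit_int (h r $ j) * y r)"
      by (simp add: sum.distrib sum_subtractf sum_distrib_left)
    \<comment> \<open>Column \<open>e\<close> consists of signs 1, so this is the inner product of
      columns \<open>j\<close> and \<open>e\<close>.\<close>
    also have "(\<Sum>r\<in>UNIV. bit_sign (h r $ j)) = (if j = e then 4 * int n else 0)"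
      using col[of j e] e card by simp
    finally have "4 * (int n * ?V j) = 4 * ((if j = e then int n * w else 0) - (\<Sum>r\<in>UNIV. y r)
        + 2 * (\<Sum>r\<in>UNIV. bit_int (h r $ j) * y r))"
      by (simp add: algebra_simps)
    then show ?thesis
      unfolding mult_cancel_left by (simp only: zero_neq_numeral[symmetric] simp_thms)
  qed
  show thesis
    using that[OF \<open>even w\<close> eq] .
qed

text \<open>Modulo 2, with n odd and w even, the expansion equates every coordinate of
  \<open>v\<close> with the same sum of the \<open>y r\<close>, so \<open>v\<close> is
  constant.\<close>

lemma dual_code_odd:
  fixes C :: "(bit ^ 'm) set"
  assumes C: "hadamard_code C" "0 \<in> C" and card: "CARD('m) = 4 * n" and "odd n"
  shows "dual_code C = {0, 1}"
proof
  show "dual_code C \<subseteq> {0, 1}"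
  proof
    fix v assume v: "v \<in> dual_code C"
    obtain h :: "'m \<Rightarrow> bit ^ 'm" where h: "C = range h \<union> (\<lambda>v. v + 1) ` range h"
      and e: "\<And>r. h r $ undefined = 0"
      and row: "\<And>r t. sign_sum (h r + h t) = (if r = t then int CARD('m) else 0)"
      and col: "\<And>i j. (\<Sum>r\<in>UNIV. bit_sign (h r $ i) * bit_sign (h r $ j))
        = (if i = j then int CARD('m) else 0)"
      using hadamard_code_rows[OF C(1), of undefined] by blast
    have "1 \<in> C" using hadamard_code_complement[OF C] by simp
    then have "bit_dot v (h r) = 0" "bit_dot v 1 = 0" for r
      using v h unfolding dual_code_def by blast+
    then obtain w y where "even w"
      and eq: "\<And>j. int n * bit_int (v $ j) = (if j = undefined then int n * w else 0) - (\<Sum>r\<in>UNIV. y r)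
             + 2 * (\<Sum>r\<in>UNIV. bit_int (h r $ j) * y r)"
      using dual_code_expansion[OF card e col] by blast
    have "v $ j = of_int (\<Sum>r\<in>UNIV. y r)" for j
    proof -
      have "even (int n * bit_int (v $ j) + (\<Sum>r\<in>UNIV. y r))"
        unfolding eq using \<open>even w\<close> by simp
      then have "even (bit_int (v $ j)) \<longleftrightarrow> even (\<Sum>r\<in>UNIV. y r)"
        using \<open>odd n\<close> by simp
      then have "v $ j = 0 \<longleftrightarrow> (of_int (\<Sum>r\<in>UNIV. y r) :: bit) = 0"
        unfolding of_int_bit_eq_0_iff by simp
      then show ?thesis by (cases "v $ j = 0") simp_all
    qed
    then have "v = (if (of_int (\<Sum>r\<in>UNIV. y r) :: bit) = 0 then 0 else 1)"
      by (simp add: vec_eq_iff)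
    then show "v \<in> {0, 1}" by (simp split: if_splits)
  qed
  show "{0, 1} \<subseteq> dual_code C"
    using hadamard_code_one_in_dual[OF C card] by (auto simp: dual_code_def bit_dot_def)
qed

text \<open>The length is 8n here, so the expansion has 2n in place of n and can be halved. Reduced
  modulo 2, the result writes \<open>v\<close> as a combination of \<open>1\<close> and the
  rows.\<close>

lemma dual_code_subset_span:
  fixes C :: "(bit ^ 'm) set"
  assumes C: "hadamard_code C" "0 \<in> C" and card: "CARD('m) = 4 * (2 * n)" and "odd n"
  shows "dual_code C \<subseteq> vec.span C"
proof
  fix v assume v: "v \<in> dual_code C"
  obtain h :: "'m \<Rightarrow> bit ^ 'm" where h: "C = range h \<union> (\<lambda>v. v + 1) ` range h"
    and e: "\<And>r. h r $ undefined = 0"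
    and row: "\<And>r t. sign_sum (h r + h t) = (if r = t then int CARD('m) else 0)"
    and col: "\<And>i j. (\<Sum>r\<in>UNIV. bit_sign (h r $ i) * bit_sign (h r $ j))
      = (if i = j then int CARD('m) else 0)"
    using hadamard_code_rows[OF C(1), of undefined] by blast
  have one: "1 \<in> C" using hadamard_code_complement[OF C] by simp
  then have "bit_dot v (h r) = 0" "bit_dot v 1 = 0" for r
    using v h unfolding dual_code_def by blast+
  then obtain w y where "even w"
    and eq: "\<And>j. int (2 * n) * bit_int (v $ j) = (if j = undefined then int (2 * n) * w else 0)
           - (\<Sum>r\<in>UNIV. y r) + 2 * (\<Sum>r\<in>UNIV. bit_int (h r $ j) * y r)"
    using dual_code_expansion[OF card e col] by blast
  \<comment> \<open>In the expansion at any one coordinate all the other terms are even.\<close>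
  have "even (\<Sum>r\<in>UNIV. y r)"
  proof -
    have "(\<Sum>r\<in>UNIV. y r) = (if undefined = (undefined :: 'm) then int (2 * n) * w else 0)
        + 2 * (\<Sum>r\<in>UNIV. bit_int (h r $ undefined) * y r) - int (2 * n) * bit_int (v $ undefined)"
      using eq[of undefined] by linarith
    then show ?thesis by simp
  qed
  then obtain z where z: "(\<Sum>r\<in>UNIV. y r) = 2 * z" by (elim evenE)
  have "v $ j = of_int z + (\<Sum>r\<in>UNIV. of_int (y r) * h r $ j)" for j
  proof -
    have "int n * bit_int (v $ j) = (if j = undefined then int n * w else 0)
        - z + (\<Sum>r\<in>UNIV. bit_int (h r $ j) * y r)"
      using eq[of j] unfolding z by (simp split: if_splits)
    then have "(of_int (int n * bit_int (v $ j)) :: bit) = of_int ((if j = undefined then int n * w else 0)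
        - z + (\<Sum>r\<in>UNIV. bit_int (h r $ j) * y r))"
      by (rule arg_cong)
    moreover have "(of_int (int n) :: bit) = 1" "(of_int w :: bit) = 0"
      using \<open>odd n\<close> \<open>even w\<close> of_int_bit_eq_0_iff[of "int n"] of_int_bit_eq_0_iff[of w]
      by (simp_all del: of_int_of_nat_eq)
    ultimately show ?thesis
      by (simp add: mult.commute split: if_splits)
  qed
  then have "v = of_int z *s 1 + (\<Sum>r\<in>UNIV. of_int (y r) *s h r)"
    by (simp add: vec_eq_iff)
  also have "\<dots> \<in> vec.span C"
    using h one by (intro vec.span_add vec.span_sum vec.span_scale vec.span_base) auto
  finally show "v \<in> vec.span C" .
qed

section \<open>The rank from the sizes of the span and its dual\<close>

lemma code_rank_odd:
  fixes C :: "(bit ^ 'm) set"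
  assumes "hadamard_code C" "0 \<in> C" "CARD('m) = 4 * n" "odd n"
  shows "code_rank C = 4 * n - 1"
proof -
  have "(2::nat) ^ code_rank C * 2 = 2 ^ (4 * n)"
    using card_mult_card_dual_code[OF vec.subspace_span, of C] assms(3)
      card_bit_subspace[OF vec.subspace_span, of C]
    by (simp add: dual_code_span dual_code_odd[OF assms] code_rank_def)
  then have "(2::nat) ^ Suc (code_rank C) = 2 ^ (4 * n)" by simp
  then have "Suc (code_rank C) = 4 * n" by (subst (asm) power_inject_exp) simp_all
  then show ?thesis by simp
qed

text \<open>The span lies in its dual, so the square of its size is at most 2^(4n).\<close>

lemma code_rank_even:
  fixes C :: "(bit ^ 'm) set"
  assumes "hadamard_code C" "0 \<in> C" "CARD('m) = 4 * n" "even n"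
  shows "code_rank C \<le> 2 * n"
proof -
  have "vec.span C \<subseteq> dual_code (vec.span C)"
    unfolding dual_code_span
    by (intro vec.span_minimal subspace_dual_code hadamard_code_subset_dual[OF assms])
  then have "card (vec.span C) \<le> card (dual_code (vec.span C))"
    by (intro card_mono) simp_all
  then have "card (vec.span C) * card (vec.span C) \<le> 2 ^ (4 * n)"
    unfolding assms(3)[symmetric] card_mult_card_dual_code[OF vec.subspace_span, of C, symmetric]
    by simp
  then have "(2::nat) ^ (2 * code_rank C) \<le> 2 ^ (4 * n)"
    by (simp add: card_bit_subspace[OF vec.subspace_span] code_rank_def mult_2 power_add)
  then show ?thesis by (subst (asm) power_increasing_iff) simp_all
qed

text \<open>The dual lies in the span, which reverses the inequality for self-orthogonal spans; both
  together give half the length 8n.\<close>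

lemma code_rank_twice_odd:
  fixes C :: "(bit ^ 'm) set"
  assumes "hadamard_code C" "0 \<in> C" "CARD('m) = 4 * (2 * n)" "odd n"
  shows "code_rank C = 2 * (2 * n)"
proof -
  have "dual_code (vec.span C) \<subseteq> vec.span C"
    unfolding dual_code_span by (rule dual_code_subset_span[OF assms])
  then have "card (dual_code (vec.span C)) \<le> card (vec.span C)"
    by (intro card_mono) simp_all
  then have "2 ^ (4 * (2 * n)) \<le> card (vec.span C) * card (vec.span C)"
    unfolding assms(3)[symmetric] card_mult_card_dual_code[OF vec.subspace_span, of C, symmetric]
    by simp
  then have "(2::nat) ^ (4 * (2 * n)) \<le> 2 ^ (2 * code_rank C)"
    by (simp add: card_bit_subspace[OF vec.subspace_span] code_rank_def mult_2 power_add)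
  then have "2 * (2 * n) \<le> code_rank C" by (subst (asm) power_increasing_iff) simp_all
  moreover have "code_rank C \<le> 2 * (2 * n)"
    by (rule code_rank_even[OF assms(1-3)]) simp
  ultimately show ?thesis by simp
qed

section \<open>The kernel of a Hadamard code\<close>

text \<open>A translation is injective, so mapping the finite set \<open>C\<close> into itself
  already makes it onto.\<close>

lemma code_kernel_iff: "z \<in> code_kernel C \<longleftrightarrow> (\<forall>c\<in>C. c + z \<in> C)"
proof
  assume "\<forall>c\<in>C. c + z \<in> C"
  then have "(\<lambda>c. c + z) ` C \<subseteq> C" by blast
  moreover have "inj_on (\<lambda>c. c + z) C" by (rule inj_onI) simp
  ultimately have "(\<lambda>c. c + z) ` C = C" by (intro endo_inj_surj) simp_all
  then show "z \<in> code_kernel C" by (simp add: code_kernel_def)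
qed (auto simp: code_kernel_def)

lemma subspace_code_kernel: "vec.subspace (code_kernel C)"
  unfolding subspace_bit_vec_iff by (simp add: code_kernel_iff flip: add.assoc)

lemma code_kernel_subset: "0 \<in> C \<Longrightarrow> code_kernel C \<subseteq> C"
  by (force simp: code_kernel_iff)

lemma one_in_code_kernel: "hadamard_code C \<Longrightarrow> 1 \<in> code_kernel C"
  by (simp add: code_kernel_iff hadamard_code_complement)

text \<open>Two codewords whose sum leaves \<open>C\<close> will do. Together with 0 they represent
  three different cosets of the kernel.\<close>

lemma nonlinear_code_kernel:
  assumes "0 \<in> C" "\<not> vec.subspace C"
  obtains x y where "x \<in> C" "y \<in> C" "x \<notin> code_kernel C" "y \<notin> code_kernel C" "x + y \<notin> code_kernel C"
proof -
  obtain x y where xy: "x \<in> C" "y \<in> C" "x + y \<notin> C"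
    using assms by (auto simp: subspace_bit_vec_iff)
  have "y \<notin> code_kernel C" using xy by (auto simp: code_kernel_iff)
  moreover have "x \<notin> code_kernel C" 
    using xy(2,3) unfolding add.commute[of x y] by (auto simp: code_kernel_iff)
  moreover have "x + y \<notin> code_kernel C" using xy(3) code_kernel_subset[OF assms(1)] by blast
  ultimately show thesis using that xy by blast
qed

text \<open>Fourier inversion over \<open>K\<close>; it transfers orthogonality from all coordinates to one block.\<close>

lemma sum_block:
  assumes K: "vec.subspace (K :: (bit ^ 'm) set)"
  shows "(\<Sum>z\<in>K. bit_sign (z $ e) * sign_sum (v + z))
    = int (card K) * (\<Sum>i\<in>{i. \<forall>z\<in>K. z $ i = z $ e}. bit_sign (v $ i))"
proof -
  let ?B = "{i. \<forall>z\<in>K. z $ i = z $ e}"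
  have "(\<Sum>z\<in>K. bit_sign (z $ e) * sign_sum (v + z))
      = (\<Sum>z\<in>K. \<Sum>i\<in>UNIV. bit_sign (v $ i) * bit_sign (z $ i + z $ e))"
    unfolding sign_sum_def sum_distrib_left
    by (intro sum.cong HOL.refl) (simp add: bit_sign_add)
  also have "\<dots> = (\<Sum>i\<in>UNIV. bit_sign (v $ i) * (\<Sum>z\<in>K. bit_sign (z $ i + z $ e)))"
    by (subst sum.swap) (simp only: sum_distrib_left)
  also have "\<dots> = (\<Sum>i\<in>UNIV. if i \<in> ?B then bit_sign (v $ i) * int (card K) else 0)"
  proof (intro sum.cong HOL.refl)
    fix i
    have eq: "x + y = 0 \<longleftrightarrow> x = y" for x y :: bit
      by (cases "x = 0"; cases "y = 0") simp_all
    \<comment> \<open>This character sum detects whether all words of \<open>K\<close> agree at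
      \<open>i\<close> and \<open>e\<close>.\<close>
    have "(\<Sum>z\<in>K. bit_sign (z $ i + z $ e))
        = (if \<forall>z\<in>K. z $ i + z $ e = 0 then int (card K) else 0)"
      using K by (intro sum_bit_sign) (simp_all add: subspace_bit_vec_iff ac_simps)
    then have "(\<Sum>z\<in>K. bit_sign (z $ i + z $ e)) = (if i \<in> ?B then int (card K) else 0)"
      by (simp only: eq mem_Collect_eq)
    then show "bit_sign (v $ i) * (\<Sum>z\<in>K. bit_sign (z $ i + z $ e))
        = (if i \<in> ?B then bit_sign (v $ i) * int (card K) else 0)"
      by (cases "i \<in> ?B") (simp_all only: if_True if_False mult_zero_right)
  qed
  also have "\<dots> = (\<Sum>i\<in>?B. bit_sign (v $ i) * int (card K))"
    by (simp add: sum.If_cases)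
  also have "\<dots> = int (card K) * (\<Sum>i\<in>?B. bit_sign (v $ i))"
    by (simp only: sum_distrib_left mult.commute)
  finally show ?thesis .
qed

lemma code_kernel_dvd:
  fixes C :: "(bit ^ 'm) set"
  assumes C: "hadamard_code C" "0 \<in> C" "\<not> vec.subspace C"
  shows "2 ^ (vec.dim (code_kernel C) + 2) dvd 2 * CARD('m)"
proof -
  let ?K = "code_kernel C"
  define B where "B = {i :: 'm. \<forall>z\<in>?K. z $ i = z $ undefined}"
  note K = subspace_code_kernel[of C]
  have K0: "0 \<in> ?K" and Kadd: "\<And>x y. x \<in> ?K \<Longrightarrow> y \<in> ?K \<Longrightarrow> x + y \<in> ?K"
    using K by (simp_all add: subspace_bit_vec_iff)
  have K1: "1 \<in> ?K" by (rule one_in_code_kernel[OF C(1)])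
  have cardK: "card ?K = 2 ^ vec.dim ?K" by (rule card_bit_subspace[OF K])
  \<comment> \<open>When \<open>x\<close> and \<open>y\<close> lie in different kernel cosets,
    \<open>x\<close> is neither \<open>y + z\<close> nor its complement for a kernel word
    \<open>z\<close>, so every term of the block formula vanishes.\<close>
  have orth: "(\<Sum>i\<in>B. bit_sign (x $ i) * bit_sign (y $ i)) = 0"
    if xy: "x \<in> C" "y \<in> C" "x + y \<notin> ?K" for x y
  proof -
    have "sign_sum (x + y + z) = 0" if z: "z \<in> ?K" for z
    proof -
      have "y + z \<in> C" using z xy(2) by (simp add: code_kernel_iff)
      moreover have "x \<noteq> y + z"
      proof
        assume "x = y + z"
        then have "x + y = z" by (simp add: ac_simps)
        then show False using xy(3) z by simp
      qed
      moreover have "x \<noteq> y + z + 1"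
      proof
        assume "x = y + z + 1"
        then have "x + y = z + 1" by (simp add: ac_simps)
        then show False using xy(3) Kadd[OF z K1] by simp
      qed
      ultimately show ?thesis
        using hadamard_code_sign_sum[OF C(1) xy(1)] by (simp add: add.assoc)
    qed
    then have "int (card ?K) * (\<Sum>i\<in>B. bit_sign ((x + y) $ i)) = 0"
      unfolding B_def sum_block[OF K, symmetric] by simp
    then show ?thesis
      by (simp add: cardK bit_sign_add)
  qed
  \<comment> \<open>The block formula at the zero vector gives the size of the block: only the
    kernel words 0 and 1 have nonzero \<open>sign_sum\<close>, and each contributes the
    length.\<close>
  have "int (card ?K) * int (card B) = (\<Sum>z\<in>?K. bit_sign (z $ undefined) * sign_sum (0 + z))"
    unfolding sum_block[OF K] B_def by simp
  also have "\<dots> = (\<Sum>z\<in>{0, 1 :: bit ^ 'm}. bit_sign (z $ undefined) * sign_sum (0 + z))"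
  proof (intro sum.mono_neutral_right ballI)
    fix z assume "z \<in> ?K - {0, 1}"
    then have "z \<in> C" "z \<noteq> 0" "z \<noteq> 0 + 1" using code_kernel_subset[OF C(2)] by auto
    then show "bit_sign (z $ undefined) * sign_sum (0 + z) = 0"
      using hadamard_code_sign_sum[OF C(1) _ C(2)] by simp
  qed (use K0 K1 in auto)
  also have "\<dots> = int (2 * CARD('m))"
    by (simp add: vec_eq_iff)
  finally have card: "card ?K * card B = 2 * CARD('m)"
    by (simp only: of_nat_mult[symmetric] of_nat_eq_iff)
  obtain x y where xy: "x \<in> C" "y \<in> C" "x \<notin> ?K" "y \<notin> ?K" "x + y \<notin> ?K"
    by (rule nonlinear_code_kernel[OF C(2,3)])
  \<comment> \<open>In the expanded product the signs of \<open>x\<close>, \<open>y\<close> and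
    \<open>x + y\<close> all sum to 0 over \<open>B\<close>. Each factor is 0 or 2, so the sum is
    divisible by 4.\<close>
  have "(\<Sum>i\<in>B. (1 + bit_sign (x $ i)) * (1 + bit_sign (y $ i))) = int (card B)"
    using orth[OF xy(1) C(2)] orth[OF xy(2) C(2)] orth[OF xy(1,2,5)] xy(3,4)
    by (simp add: algebra_simps sum.distrib)
  moreover have "4 dvd (\<Sum>i\<in>B. (1 + bit_sign (x $ i)) * (1 + bit_sign (y $ i)))"
    by (intro dvd_sum) (simp add: bit_sign_def)
  ultimately have "4 dvd card B"
    by (simp add: int_dvd_int_iff[symmetric])
  then have "2 ^ vec.dim ?K * 4 dvd card ?K * card B"
    unfolding cardK by (intro mult_dvd_mono) simp_all
  then show ?thesis
    unfolding card by (simp add: power_add)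
qed

section \<open>Dicyclic groups\<close>

text \<open>The order is an assumption because it comes from the code, which has 8n words; it forces
  \<open>a\<close> to have order exactly 4n.\<close>

locale dicyclic_group = group G for G (structure) +
  fixes a b and n :: nat
  assumes a [simp]: "a \<in> carrier G" and b [simp]: "b \<in> carrier G"
    and a_pow: "a [^] (4 * n) = \<one>"
    and b_sq: "b \<otimes> b = a [^] (2 * n)"
    and conj: "inv b \<otimes> a \<otimes> b = inv a"
    and gen: "carrier G = generate G {a, b}"
    and n: "n > 0"
    and order: "order G = 8 * n"
begin

text \<open>Exponents are natural numbers, so 4n - 1 plays the role of -1 modulo 4n.\<close>

lemma inv_a_pow: "inv a [^] (i :: nat) = a [^] ((4 * n - 1) * i)"
proof -
  have "a \<otimes> a [^] (4 * n - 1) = a [^] (1 + (4 * n - 1))"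
    by (subst nat_pow_mult[symmetric]) simp_all
  also have "\<dots> = \<one>" using a_pow n by simp
  finally have "inv a = a [^] (4 * n - 1)" by (intro inv_equality) (simp_all flip: nat_pow_Suc2)
  then show ?thesis by (simp add: nat_pow_pow)
qed

lemma b_mult_a_pow: "b \<otimes> a [^] (i :: nat) = a [^] ((4 * n - 1) * i) \<otimes> b"
proof -
  have "a \<otimes> b = b \<otimes> inv a"
    using conj by (metis a b inv_closed inv_solve_left m_assoc m_closed)
  then have step: "b \<otimes> a = inv a \<otimes> b"
    by (metis a b inv_closed inv_solve_left inv_solve_right m_assoc m_closed)
  have "b \<otimes> a [^] i = inv a [^] i \<otimes> b"
  proof (induction i)
    case (Suc i)
    have "b \<otimes> a [^] Suc i = (b \<otimes> a [^] i) \<otimes> a" by (simp add: m_assoc)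
    also have "\<dots> = inv a [^] i \<otimes> (b \<otimes> a)" by (simp add: Suc m_assoc)
    also have "\<dots> = inv a [^] Suc i \<otimes> b" by (simp add: step m_assoc)
    finally show ?case .
  qed simp
  then show ?thesis by (simp add: inv_a_pow)
qed

text \<open>The exponent is i - j + 2n modulo 4n; in particular the product of two elements outside
  the powers of \<open>a\<close> is a power of \<open>a\<close>.\<close>

lemma reflection_mult:
  "(a [^] (i :: nat) \<otimes> b) \<otimes> (a [^] (j :: nat) \<otimes> b) = a [^] (i + (4 * n - 1) * j + 2 * n)"
proof -
  have "(a [^] i \<otimes> b) \<otimes> (a [^] j \<otimes> b) = a [^] i \<otimes> (b \<otimes> a [^] j) \<otimes> b"
    by (simp add: m_assoc)
  also have "\<dots> = a [^] i \<otimes> a [^] ((4 * n - 1) * j) \<otimes> (b \<otimes> b)"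
    by (simp add: b_mult_a_pow m_assoc)
  finally show ?thesis by (simp add: b_sq nat_pow_mult)
qed

text \<open>The elements of these two shapes are closed under products and include the generators
  and their inverses.\<close>

lemma carrier_cases:
  assumes "x \<in> carrier G"
  obtains i :: nat where "x = a [^] i" | i :: nat where "x = a [^] i \<otimes> b"
proof -
  let ?X = "range (\<lambda>i :: nat. a [^] i) \<union> range (\<lambda>i :: nat. a [^] i \<otimes> b)"
  have mult: "x \<otimes> y \<in> ?X" if xy: "x \<in> ?X" "y \<in> ?X" for x y
  proof -
    have "a [^] i \<otimes> a [^] j = a [^] (i + j)"
      "a [^] i \<otimes> (a [^] j \<otimes> b) = a [^] (i + j) \<otimes> b"
      "(a [^] i \<otimes> b) \<otimes> a [^] j = a [^] (i + (4 * n - 1) * j) \<otimes> b" for i j :: nat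
      by (simp_all add: nat_pow_mult m_assoc b_mult_a_pow flip: m_assoc[of "a [^] i"])
    then show ?thesis using xy reflection_mult by blast
  qed
  have pow: "a [^] i \<in> ?X" and powb: "a [^] i \<otimes> b \<in> ?X" for i :: nat by blast+
  have "generate G {a, b} \<subseteq> ?X"
  proof
    fix x assume "x \<in> generate G {a, b}"
    then show "x \<in> ?X"
    proof (induction rule: generate.induct)
      case one
      show ?case using pow[of 0] by simp
    next
      case (incl h)
      then show ?case using pow[of 1] powb[of 0] by auto
    next
      case (inv h)
      have "inv a = a [^] ((4 * n - 1) * 1)" using inv_a_pow[of 1] by simp
      moreover have "inv b = a [^] (2 * n) \<otimes> b"
      proof (rule inv_equality)
        have "a [^] (2 * n) \<otimes> b \<otimes> b = a [^] (2 * n) \<otimes> a [^] (2 * n)"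
          by (simp add: m_assoc b_sq)
        also have "\<dots> = \<one>" using a_pow by (simp add: nat_pow_mult)
        finally show "a [^] (2 * n) \<otimes> b \<otimes> b = \<one>" .
      qed simp_all
      ultimately show ?case using inv pow[of "(4 * n - 1) * 1"] powb[of "2 * n"] by auto
    next
      case (eng h1 h2)
      then show ?case by (intro mult)
    qed
  qed
  then show thesis using assms that gen by blast
qed

text \<open>The 8n elements are covered by two sets of at most \<open>ord a\<close> elements each,
  so \<open>ord a\<close> is at least 4n; it also divides 4n.\<close>

lemma pow_a_eq_one_iff: "a [^] (i :: nat) = \<one> \<longleftrightarrow> 4 * n dvd i"
proof -
  have dvd: "ord a dvd 4 * n"
    using a_pow pow_eq_id[OF a] by simp
  then have pos: "ord a > 0" using n by (intro Nat.gr0I) simp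
  have mod: "a [^] (i :: nat) = a [^] (i mod ord a)" for i
  proof -
    have "a [^] i = a [^] (ord a * (i div ord a)) \<otimes> a [^] (i mod ord a)"
      by (simp add: nat_pow_mult)
    also have "a [^] (ord a * (i div ord a)) = \<one>"
      using pow_eq_id[OF a] by simp
    finally show ?thesis by simp
  qed
  have "carrier G \<subseteq> (\<lambda>i. a [^] i) ` {..<ord a} \<union> (\<lambda>i. a [^] i \<otimes> b) ` {..<ord a}" (is "_ \<subseteq> ?Y")
  proof
    fix x assume "x \<in> carrier G"
    then show "x \<in> ?Y"
    proof (cases rule: carrier_cases)
      case (1 i)
      then show ?thesis using mod[of i] pos by auto
    next
      case (2 i)
      then show ?thesis using mod[of i] pos by auto
    qed
  qed
  then have "card (carrier G) \<le> card ?Y"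
    by (intro card_mono) simp_all
  also have "\<dots> \<le> card ((\<lambda>i. a [^] i) ` {..<ord a}) + card ((\<lambda>i. a [^] i \<otimes> b) ` {..<ord a})"
    by (rule card_Un_le)
  also have "\<dots> \<le> ord a + ord a"
    by (intro add_mono order_trans[OF card_image_le]) simp_all
  finally have "4 * n \<le> ord a"
    using order by (simp add: order_def)
  then have "ord a = 4 * n"
    using dvd_imp_le[OF dvd] n by simp
  then show ?thesis using pow_eq_id[OF a] by simp
qed

text \<open>Otherwise \<open>H\<close> contains at most two powers of \<open>a\<close>. Left
  multiplication by one of its other elements maps all of these injectively to powers of
  \<open>a\<close> in \<open>H\<close>, so \<open>H\<close> has at most four elements.\<close>

lemma subgroup_rotation:
  assumes H: "subgroup H G" and card: "card H > 4"
  shows "\<exists>i :: nat. a [^] i \<in> H \<and> \<not> 2 * n dvd i"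
proof (rule ccontr)
  let ?A = "range (\<lambda>i :: nat. a [^] i)"
  assume "\<not> ?thesis"
  then have *: "2 * n dvd i" if "a [^] i \<in> H" for i using that by blast
  have "H \<inter> ?A \<subseteq> {\<one>, a [^] (2 * n)}"
  proof
    fix x assume "x \<in> H \<inter> ?A"
    then obtain i :: nat where i: "x = a [^] i" "a [^] i \<in> H" by blast
    obtain q where q: "i = 2 * n * q" using *[OF i(2)] by (elim dvdE)
    show "x \<in> {\<one>, a [^] (2 * n)}"
    proof (cases "even q")
      case True
      then have "4 * n dvd i" unfolding q by (auto elim!: evenE)
      then show ?thesis using i pow_a_eq_one_iff by simp
    next
      case False
      then obtain p where "q = 2 * p + 1" by (elim oddE)
      then have "i = 4 * n * p + 2 * n" unfolding q by (simp add: algebra_simps)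
      then have "a [^] i = a [^] (4 * n * p) \<otimes> a [^] (2 * n)" by (simp add: nat_pow_mult)
      moreover have "a [^] (4 * n * p) = \<one>" by (simp add: pow_a_eq_one_iff)
      ultimately show ?thesis using i by simp
    qed
  qed
  then have "card (H \<inter> ?A) \<le> card {\<one>, a [^] (2 * n)}" by (rule card_mono[rotated]) simp
  then have le2: "card (H \<inter> ?A) \<le> 2" using card_insert_le_m1[of 2 "{a [^] (2 * n)}" \<one>] by simp
  have fin: "finite H" using card by (intro card_ge_0_finite) simp
  have "card (H - ?A) \<le> card (H \<inter> ?A)"
  proof (cases "H - ?A = {}")
    case True
    then show ?thesis by (simp only: card.empty)
  next
    case False
    then obtain y where y: "y \<in> H" "y \<notin> ?A" by blast
    have HG: "H \<subseteq> carrier G" using H by (rule subgroup.subset)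
    have reflection: "\<exists>i :: nat. x = a [^] i \<otimes> b" if x: "x \<in> H" "x \<notin> ?A" for x
    proof -
      have "x \<in> carrier G" using x HG by blast
      then show ?thesis using x(2) by (cases rule: carrier_cases) blast+
    qed
    show ?thesis
    proof (rule card_inj_on_le)
      show "inj_on (\<lambda>x. y \<otimes> x) (H - ?A)"
        using HG y(1) by (intro inj_onI) (simp add: subset_iff)
      show "(\<lambda>x. y \<otimes> x) ` (H - ?A) \<subseteq> H \<inter> ?A"
      proof (intro image_subsetI IntI)
        fix x assume x: "x \<in> H - ?A"
        show "y \<otimes> x \<in> H" using subgroup.m_closed[OF H y(1)] x by simp
        obtain i j :: nat where "y = a [^] i \<otimes> b" "x = a [^] j \<otimes> b" using reflection y x by blast
        then have "y \<otimes> x = a [^] (i + (4 * n - 1) * j + 2 * n)" using reflection_mult by simp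
        then show "y \<otimes> x \<in> ?A" by blast
      qed
      show "finite (H \<inter> ?A)" using fin by simp
    qed
  qed
  moreover have "card H = card (H \<inter> ?A) + card (H - ?A)"
    using card_Un_disjoint[of "H \<inter> ?A" "H - ?A"] fin by (simp add: Int_Diff_Un Int_Diff_disjoint)
  ultimately show False using le2 card by simp
qed

lemma subgroup_two_power:
  assumes H: "subgroup H G" and card: "card H = 2 ^ k" and k: "k > 2"
  obtains i :: nat where "a [^] (n * i) \<in> H" "a [^] (n * i) \<otimes> a [^] (n * i) \<noteq> \<one>"
proof -
  have "(2::nat) ^ 3 \<le> 2 ^ k" using k by (intro power_increasing) simp_all
  then have "card H > 4" using card by simp
  then obtain i :: nat where i: "a [^] i \<in> H" "\<not> 2 * n dvd i"
    using subgroup_rotation[OF H] by blast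
  interpret H: group "G\<lparr>carrier := H\<rparr>" using H by (rule subgroup_imp_group)
  have pow_H: "(a [^] i) [^] m \<in> H" for m :: nat
    by (induction m) (simp_all add: subgroup.one_closed[OF H] subgroup.m_closed[OF H] i)
  have "(a [^] i) [^] ((2::nat) ^ k) = \<one>"
    using H.pow_order_eq_1[of "a [^] i"] i card by (simp add: order_def nat_pow_consistent[symmetric])
  then have k': "4 * n dvd i * 2 ^ k" by (simp add: nat_pow_pow pow_a_eq_one_iff)
  \<comment> \<open>The order of \<open>a [^] i\<close> is \<open>2 ^ m\<close>. Since this element
    is neither the identity nor \<open>a [^] (2 * n)\<close>, \<open>m\<close> is at least 2, and
    raising to the power \<open>2 ^ (m - 2)\<close> leaves an element of order 4.\<close>
  define m where "m = (LEAST m. 4 * n dvd i * 2 ^ m)"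
  have m: "4 * n dvd i * 2 ^ m" unfolding m_def using k' by (rule LeastI)
  have "m \<noteq> 0"
  proof
    assume "m = 0"
    then have "2 * (2 * n) dvd i" using m by simp
    then show False using i(2) dvd_mult_right by blast
  qed
  moreover have "m \<noteq> 1"
  proof
    assume "m = 1"
    then have "2 * (2 * n) dvd 2 * i" using m by (simp add: mult.commute)
    then show False using i(2) by simp
  qed
  ultimately obtain l where l: "m = l + 2" by (metis One_nat_def Suc_1 add_2_eq_Suc' not0_implies_Suc)
  have "4 * n dvd 4 * (i * 2 ^ l)" using m l by (simp add: power_add ac_simps)
  then have "n dvd i * 2 ^ l" by simp
  then obtain j where j: "i * 2 ^ l = n * j" by (elim dvdE)
  have "a [^] (n * j) \<in> H"
    using pow_H[of "2 ^ l"] by (simp add: nat_pow_pow j)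
  moreover have "\<not> 4 * n dvd i * 2 ^ (l + 1)"
    using not_less_Least[of "l + 1" "\<lambda>m. 4 * n dvd i * 2 ^ m"] l unfolding m_def by simp
  then have "\<not> 4 * n dvd n * j + n * j"
    unfolding j[symmetric] by (simp add: mult_2 distrib_left)
  then have "a [^] (n * j) \<otimes> a [^] (n * j) \<noteq> \<one>"
    using pow_a_eq_one_iff by (simp add: nat_pow_mult)
  ultimately show thesis using that by blast
qed

end

section \<open>Propelinear codes of type Q\<close>

lemma (in group) word_eval_replicate:
  assumes "f g \<in> carrier G"
  shows "word_eval G f (replicate m (g, True)) = f g [^] m"
  using assms by (induction m) (simp_all flip: nat_pow_Suc2)

text \<open>Each defining relation is evaluated in the group; the order is the number of
  codewords.\<close>

lemma type_Q_dicyclic: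
  fixes C :: "(bit ^ 'm) set"
  assumes card: "CARD('m) = 4 * n" and "propelinear C \<pi>" "hadamard_code C"
    and Q: "type_Q n C \<pi> a b"
  shows "dicyclic_group (propelinear_group C \<pi>) a b n"
proof -
  define G where "G = propelinear_group C \<pi>"
  define f where "f = case_gen a b"
  interpret group G unfolding G_def by (rule group_propelinear_group[OF assms(2)])
  have range: "range f = {a, b}"
    by (auto simp: f_def split: gen.splits intro: rev_image_eqI[of Gen_a] rev_image_eqI[of Gen_b])
  have ab: "a \<in> carrier G" "b \<in> carrier G" and gen: "generate G {a, b} = carrier G"
    and eq: "\<And>u v. word_eval G f u = word_eval G f v \<longleftrightarrow> presented_eq (type_Q_relations n) u v"
    using Q unfolding type_Q_def has_presentation_def G_def[symmetric] f_def[symmetric] range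
    by auto
  have rel: "word_eval G f u = word_eval G f v" if "(u, v) \<in> type_Q_relations n" for u v
    unfolding eq using that by (rule presented_eq.relation)
  have f: "f Gen_a = a" "f Gen_b = b" by (simp_all add: f_def)
  show ?thesis
    unfolding G_def[symmetric]
  proof unfold_locales
    show "a [^]\<^bsub>G\<^esub> (4 * n) = \<one>\<^bsub>G\<^esub>"
      using rel[of "replicate (4 * n) (Gen_a, True)" "[]"] word_eval_replicate[of f Gen_a "4 * n"] ab
      by (simp add: type_Q_relations_def f)
    show "b \<otimes>\<^bsub>G\<^esub> b = a [^]\<^bsub>G\<^esub> (2 * n)"
      using rel[of "replicate (2 * n) (Gen_a, True)" "[(Gen_b, True), (Gen_b, True)]"]
        word_eval_replicate[of f Gen_a "2 * n"] ab
      by (simp add: type_Q_relations_def f)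
    show "inv\<^bsub>G\<^esub> b \<otimes>\<^bsub>G\<^esub> a \<otimes>\<^bsub>G\<^esub> b = inv\<^bsub>G\<^esub> a"
      using rel[of "[(Gen_b, False), (Gen_a, True), (Gen_b, True)]" "[(Gen_a, False)]"] ab
      by (simp add: type_Q_relations_def f m_assoc)
    show "carrier G = generate G {a, b}" using gen by simp
    show "n > 0"
    proof (rule Nat.gr0I)
      assume "n = 0"
      then show False using card by simp
    qed
    show "order G = 8 * n"
      using card_hadamard_code[OF assms(3)] card
      by (simp add: order_def G_def propelinear_group_def)
  qed (use ab in simp_all)
qed

section \<open>The permutation action on the code and its kernel\<close>

lemma perm_vec_zero [simp]: "perm_vec \<sigma> (0 :: bit ^ 'm) = 0"
  by (simp add: perm_vec_def vec_eq_iff)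

lemma perm_vec_id: "perm_vec id v = v"
  by (simp add: perm_vec_def vec_eq_iff)

text \<open>Writing c as the group product of x and d turns the translate of c by the permuted z
  into the group product of x and d + z.\<close>

lemma propelinear_code_kernel:
  assumes C: "propelinear C \<pi>" and x: "x \<in> C" and z: "z \<in> code_kernel C"
  shows "perm_vec (\<pi> x) z \<in> code_kernel C"
  unfolding code_kernel_iff
proof
  fix c assume c: "c \<in> C"
  let ?G = "propelinear_group C \<pi>"
  interpret G: group ?G by (rule group_propelinear_group[OF C])
  have carrier: "carrier ?G = C" and mult: "\<And>u v. u \<otimes>\<^bsub>?G\<^esub> v = u + perm_vec (\<pi> u) v"
    by (simp_all add: propelinear_group_def)
  define d where "d = inv\<^bsub>?G\<^esub> x \<otimes>\<^bsub>?G\<^esub> c"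
  have d: "d \<in> C" using G.m_closed G.inv_closed x c unfolding d_def carrier by blast
  have xc: "x \<in> carrier ?G" "c \<in> carrier ?G" using x c by (simp_all only: carrier)
  have "x \<otimes>\<^bsub>?G\<^esub> d = c"
    unfolding d_def using xc G.inv_closed[OF xc(1)] by (simp only: G.m_assoc[symmetric] G.r_inv G.l_one)
  then have "c + perm_vec (\<pi> x) z = x \<otimes>\<^bsub>?G\<^esub> (d + z)"
    unfolding mult by (auto simp: perm_vec_add add.assoc)
  moreover have "d + z \<in> C" using z d by (simp add: code_kernel_iff)
  ultimately show "c + perm_vec (\<pi> x) z \<in> C"
    using G.m_closed x unfolding carrier by simp
qed

text \<open>The kernel is invariant under the permutations of codewords; in characteristic 2 the
  group inverse of \<open>x\<close> is a permuted copy of \<open>x\<close>.\<close>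

lemma subgroup_code_kernel:
  assumes C: "propelinear C \<pi>"
  shows "subgroup (code_kernel C) (propelinear_group C \<pi>)"
proof -
  let ?G = "propelinear_group C \<pi>"
  interpret G: group ?G by (rule group_propelinear_group[OF C])
  have carrier: "carrier ?G = C" and mult: "\<And>u v. u \<otimes>\<^bsub>?G\<^esub> v = u + perm_vec (\<pi> u) v"
    and one: "\<one>\<^bsub>?G\<^esub> = 0"
    by (simp_all add: propelinear_group_def)
  have sub: "code_kernel C \<subseteq> C" using C by (intro code_kernel_subset) (simp add: propelinear_def)
  have K: "0 \<in> code_kernel C" "\<And>x y. x \<in> code_kernel C \<Longrightarrow> y \<in> code_kernel C \<Longrightarrow> x + y \<in> code_kernel C"
    using subspace_code_kernel[of C] by (simp_all add: subspace_bit_vec_iff)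
  show ?thesis
  proof (rule G.subgroupI)
    show "code_kernel C \<subseteq> carrier ?G" using sub by (simp add: carrier)
    show "code_kernel C \<noteq> {}" using K(1) by blast
    fix x assume x: "x \<in> code_kernel C"
    then have xC: "x \<in> C" using sub by blast
    have inv: "inv\<^bsub>?G\<^esub> x \<in> C" using G.inv_closed xC unfolding carrier by blast
    have "inv\<^bsub>?G\<^esub> x \<otimes>\<^bsub>?G\<^esub> x = 0" using G.l_inv xC unfolding carrier one by blast
    then have "inv\<^bsub>?G\<^esub> x + perm_vec (\<pi> (inv\<^bsub>?G\<^esub> x)) x = 0" unfolding mult .
    then have "inv\<^bsub>?G\<^esub> x = perm_vec (\<pi> (inv\<^bsub>?G\<^esub> x)) x"
      by (metis add.left_neutral bit_vec_add_cancel(1))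
    then show "inv\<^bsub>?G\<^esub> x \<in> code_kernel C"
      using propelinear_code_kernel[OF C inv x] by simp
    fix y assume "y \<in> code_kernel C"
    then show "x \<otimes>\<^bsub>?G\<^esub> y \<in> code_kernel C"
      unfolding mult by (intro K(2) x propelinear_code_kernel[OF C xC])
  qed
qed

text \<open>The map from codewords to permutations is a homomorphism, so powers act by
  iteration.\<close>

lemma perm_vec_nat_pow:
  assumes C: "propelinear C \<pi>" and x: "x \<in> C"
  shows "perm_vec (\<pi> (x [^]\<^bsub>propelinear_group C \<pi>\<^esub> (m :: nat))) v = (perm_vec (\<pi> x) ^^ m) v"
proof (induction m arbitrary: v)
  let ?G = "propelinear_group C \<pi>"
  interpret G: group ?G by (rule group_propelinear_group[OF C])
  have carrier: "carrier ?G = C" and mult: "\<And>u v. u \<otimes>\<^bsub>?G\<^esub> v = u + perm_vec (\<pi> u) v"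
    and one: "\<one>\<^bsub>?G\<^esub> = 0"
    by (simp_all add: propelinear_group_def)
  have pi: "\<pi> u permutes UNIV" if "u \<in> C" for u
    using C that by (simp add: propelinear_def)
  have pi_mult: "\<pi> (u \<otimes>\<^bsub>?G\<^esub> w) = \<pi> u \<circ> \<pi> w" if "u \<in> C" "w \<in> C" for u w
    using C that by (simp add: propelinear_def mult)
  have zero: "0 \<in> C" using C by (simp add: propelinear_def)
  {
    case 0
    have "\<pi> 0 \<circ> \<pi> 0 = \<pi> 0"
      using pi_mult[OF zero zero] by (simp add: mult)
    moreover have "inj (\<pi> 0)"
      by (rule permutes_inj[OF pi[OF zero]])
    ultimately have pi0: "\<pi> 0 = id"
      by (auto simp: fun_eq_iff dest: injD)
    show ?case unfolding G.nat_pow_0 one pi0 perm_vec_id by simp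
  next
    case (Suc m)
    have xm: "x [^]\<^bsub>?G\<^esub> m \<in> C" using G.nat_pow_closed x unfolding carrier by blast
    have "perm_vec (\<pi> (x [^]\<^bsub>?G\<^esub> Suc m)) v = perm_vec (\<pi> (x [^]\<^bsub>?G\<^esub> m)) (perm_vec (\<pi> x) v)"
      using perm_vec_comp[OF pi[OF xm] pi[OF x]] pi_mult[OF xm x] by simp
    then show ?case by (simp add: Suc funpow_swap1)
  }
qed

text \<open>The orbit length of \<open>v\<close> divides a power of 2, hence is one itself, and it
  is at most \<open>card S\<close>; so it divides \<open>2 ^ j\<close>.\<close>

lemma funpow_two_power_fixed:
  assumes p: "permutation p" and S: "finite S" "card S < 2 ^ Suc j" "\<And>m. (p ^^ m) v \<in> S"
    and s: "(p ^^ (2 ^ s)) v = v" and t: "j \<le> t"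
  shows "(p ^^ (2 ^ t)) v = v"
proof -
  define l where "l = least_power p v"
  have "l dvd 2 ^ s" unfolding l_def using least_power_dvd[OF p] s by blast
  then obtain i where i: "l = 2 ^ i" by (auto simp: divides_primepow_nat)
  have "distinct (support p v)" using cycle_of_permutation[OF p] .
  then have "card (set (support p v)) = length (support p v)" by (rule distinct_card)
  then have "l = card (set (support p v))" by (simp only: length_map length_upt diff_zero l_def)
  also have "\<dots> \<le> card S" using S by (intro card_mono) auto
  finally have "(2::nat) ^ i < 2 ^ Suc j" using S(2) i by simp
  then have "i < Suc j" by (subst (asm) power_strict_increasing_iff) simp_all
  then have "l dvd 2 ^ t" using t i by (simp add: le_imp_power_dvd)
  then show ?thesis unfolding l_def using least_power_dvd[OF p] by blast
qed

lemma type_Q_kernel_le: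
  fixes C :: "(bit ^ 'm) set"
  assumes card: "CARD('m) = 4 * n" and fact: "4 * n = 2 ^ s * n'"
    and C: "propelinear C \<pi>" "hadamard_code C" and Q: "type_Q n C \<pi> a b"
    and dim: "vec.dim (code_kernel C) < s"
  shows "vec.dim (code_kernel C) \<le> 2"
proof (rule ccontr)
  let ?G = "propelinear_group C \<pi>"
  let ?K = "code_kernel C"
  define k where "k = vec.dim ?K"
  assume "\<not> ?thesis"
  then have k: "k > 2" by (simp add: k_def)
  have carrier: "carrier ?G = C" and mult: "\<And>u v. u \<otimes>\<^bsub>?G\<^esub> v = u + perm_vec (\<pi> u) v"
    and one: "\<one>\<^bsub>?G\<^esub> = 0"
    by (simp_all add: propelinear_group_def)
  interpret D: dicyclic_group ?G a b n by (rule type_Q_dicyclic[OF card C Q])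
  have cardK: "card ?K = 2 ^ k" unfolding k_def by (rule card_bit_subspace[OF subspace_code_kernel])
  obtain i where i: "a [^]\<^bsub>?G\<^esub> (n * i) \<in> ?K"
      "a [^]\<^bsub>?G\<^esub> (n * i) \<otimes>\<^bsub>?G\<^esub> a [^]\<^bsub>?G\<^esub> (n * i) \<noteq> \<one>\<^bsub>?G\<^esub>"
    by (rule D.subgroup_two_power[OF subgroup_code_kernel[OF C(1)] cardK k])
  have a: "a \<in> C" using D.a by (simp add: carrier)
  \<comment> \<open>The power \<open>2 ^ s\<close> of \<open>g\<close> is the identity, and the
    power \<open>2 ^ (s - 2)\<close> is \<open>a [^] n\<close>.\<close>
  define g where "g = a [^]\<^bsub>?G\<^esub> n'"
  have g: "g \<in> C" unfolding g_def using D.nat_pow_closed[OF D.a] by (simp add: carrier)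
  let ?p = "perm_vec (\<pi> g) :: bit ^ 'm \<Rightarrow> bit ^ 'm"
  have "s = (s - 2) + 2" using dim k unfolding k_def by simp
  then have "(2::nat) ^ s = 2 ^ (s - 2) * 4" using power_add[of "2 :: nat" "s - 2" 2] by simp
  then have n: "n = n' * 2 ^ (s - 2)" using fact by simp
  have pi_g: "\<pi> g permutes UNIV" using C(1) g by (simp add: propelinear_def)
  have inj: "inj ?p" by (rule injI) (rule perm_vec_inj[OF pi_g])
  then have "bij ?p" by (simp add: bij_def finite_UNIV_inj_surj)
  then have perm: "permutation ?p" by (simp add: permutation)
  have pow_p: "(?p ^^ m) v = perm_vec (\<pi> (a [^]\<^bsub>?G\<^esub> (n' * m))) v" for m v
    using perm_vec_nat_pow[OF C(1) g, of m v] unfolding g_def by (simp add: D.nat_pow_pow)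
  have fixed: "(?p ^^ (2 ^ (s - 2))) z = z" if z: "z \<in> ?K" for z
  proof (cases "z = 0")
    case True
    have "(?p ^^ m) 0 = 0" for m by (induction m) simp_all
    then show ?thesis using True by simp
  next
    case False
    show ?thesis
    proof (rule funpow_two_power_fixed[OF perm])
      \<comment> \<open>Leaving out the fixed word 0 brings the size down to 2^k - 1, so orbit
        lengths are at most 2^(k-1); this fits below 2^(s-2) because k < s.\<close>
      show "card (?K - {0}) < 2 ^ Suc (k - 1)"
        using k cardK subspace_code_kernel[of C] by (simp add: subspace_bit_vec_iff)
      show "k - 1 \<le> s - 2" using dim k unfolding k_def by simp
      show "(?p ^^ m) z \<in> ?K - {0}" for m
      proof (induction m)
        case (Suc m)
        have "?p ((?p ^^ m) z) \<in> ?K" using Suc by (intro propelinear_code_kernel[OF C(1) g]) simp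
        moreover have "?p ((?p ^^ m) z) \<noteq> 0"
          using Suc injD[OF inj, of "(?p ^^ m) z" 0] by auto
        ultimately show ?case by simp
      qed (simp add: z False)
      have "n' * 2 ^ s = 4 * n" using fact by (simp add: mult.commute)
      then have "(?p ^^ (2 ^ s)) z = perm_vec (\<pi> (a [^]\<^bsub>?G\<^esub> (0::nat))) z"
        unfolding pow_p using D.a_pow by simp
      also have "\<dots> = z" using perm_vec_nat_pow[OF C(1) a, of 0 z] by simp
      finally show "(?p ^^ (2 ^ s)) z = z" .
    qed simp
  qed
  have triv: "perm_vec (\<pi> (a [^]\<^bsub>?G\<^esub> (n * i))) z = z" if z: "z \<in> ?K" for z
  proof -
    have "(?p ^^ (2 ^ (s - 2) * i)) z = z" for i
    proof (induction i)
      case (Suc i)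
      then show ?case using fixed[OF z] by (simp add: funpow_add)
    qed simp
    then show ?thesis unfolding pow_p by (simp add: n mult.assoc)
  qed
  have "a [^]\<^bsub>?G\<^esub> (n * i) \<otimes>\<^bsub>?G\<^esub> a [^]\<^bsub>?G\<^esub> (n * i) = \<one>\<^bsub>?G\<^esub>"
    unfolding mult one triv[OF i(1)] by simp
  then show False using i(2) by simp
qed

theorem theorem1:
  fixes C :: "(bit ^ 'm) set"
    and \<pi> :: "bit ^ 'm \<Rightarrow> 'm \<Rightarrow> 'm"
    and a b :: "bit ^ 'm"
    and n s n' r k :: nat
  assumes length: "CARD('m) = 4 * n"
    and factorization: "4 * n = 2 ^ s * n'" "odd n'"
    and hfp: "hfp_code C \<pi>"
    and type_Q: "type_Q n C \<pi> a b"
    and nonlinear: "\<not> vec.subspace C"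
    and rank: "r = code_rank C"
    and kernel: "k = vec.dim (code_kernel C)"
  shows "(s = 2 \<longrightarrow> r = 4 * n - 1 \<and> k = 1) \<and>
         (s = 3 \<longrightarrow> r = 2 * n \<and> k \<in> {1, 2}) \<and>
         (s > 3 \<longrightarrow> r \<le> 2 * n \<and> k \<in> {1, 2})"
proof -
  have propel: "propelinear C \<pi>" and had: "hadamard_code C"
    using hfp by (simp_all add: hfp_code_def)
  have zero: "0 \<in> C" using propel by (simp add: propelinear_def)
  have "2 ^ (k + 2) dvd 2 ^ (s + 1) * n'"
    using code_kernel_dvd[OF had zero nonlinear] length factorization(1) kernel by simp
  moreover have "coprime (2 ^ (k + 2)) n'"
    using factorization(2) by (simp only: coprime_power_left_iff coprime_left_2_iff_odd simp_thms)
  ultimately have "(2::nat) ^ (k + 2) dvd 2 ^ (s + 1)"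
    by (simp only: coprime_dvd_mult_left_iff)
  then have "k + 2 \<le> s + 1" by (rule power_dvd_imp_le) simp
  then have k_less: "k < s" by simp
  have k_le: "k \<le> 2"
    using type_Q_kernel_le[OF length factorization(1) propel had type_Q] k_less kernel by simp
  \<comment> \<open>The kernel contains the two different words 0 and 1.\<close>
  have "k \<noteq> 0"
  proof
    assume "k = 0"
    then have "card (code_kernel C) = 1"
      using card_bit_subspace[OF subspace_code_kernel, of C] kernel by simp
    moreover have "{0, 1} \<subseteq> code_kernel C"
      using subspace_code_kernel[of C] one_in_code_kernel[OF had] by (simp add: subspace_bit_vec_iff)
    then have "card {0, 1 :: bit ^ 'm} \<le> card (code_kernel C)"
      by (rule card_mono[rotated]) simp
    ultimately show False by (simp add: vec_eq_iff)
  qed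
  then have k: "k \<in> {1, 2}" using k_le by auto
  have "r = 4 * n - 1 \<and> k = 1" if "s = 2"
  proof -
    have "n = n'" using factorization(1) that by simp
    then show ?thesis
      using code_rank_odd[OF had zero length] factorization(2) rank k k_less that by auto
  qed
  moreover have "r = 2 * n \<and> k \<in> {1, 2}" if "s = 3"
  proof -
    have "n = 2 * n'" using factorization(1) that by simp
    then show ?thesis
      using code_rank_twice_odd[OF had zero, of n'] length factorization(2) rank k by simp
  qed
  moreover have "r \<le> 2 * n \<and> k \<in> {1, 2}" if "s > 3"
  proof -
    obtain t where "s = t + 3" using \<open>s > 3\<close> by (metis add.commute less_imp_add_positive)
    then have "n = 2 * (2 ^ t * n')" using factorization(1) by (simp add: power_add)
    then have "even n" by simp
    then show ?thesis
      using code_rank_even[OF had zero length] rank k by simp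
  qed
  ultimately show ?thesis by blast
qed

end
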